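(* Let $\mathscr{H}_S$ be a finite-dimensional complex Hilbert space, $\mathscr{H}_E$ a complex Hilbert space, $(U_t)_{t\ge 0}$ a family of unitary operators on $\mathscr{H}_S\otimes\mathscr{H}_E$, $\rho_E$ a density operator on $\mathscr{H}_E$, and $\chi$ a Hermitian trace-class operator on $\mathscr{H}_S\otimes\mathscr{H}_E$ with $\mathrm{Tr}_E\{\chi\}=0$ and $\mathrm{Tr}_S\{\chi\}=0$. For $X\in\mathcal{B}(\mathscr{H}_S)$ put $$\Phi_t[X]=\mathrm{Tr}_E\{U_t(X\otimes\rho_E)U_t^\dagger\},\qquad I_t^\chi=\mathrm{Tr}_E\{U_t\chi U_t^\dagger\},\qquad \Psi_t^\chi[X]=\Phi_t[X]+I_t^\chi\,\mathrm{Tr}\{X\},$$ and assume that $t\mapsto\Phi_t$ and $t\mapsto I_t^\chi$ are differentiable. Then for every $t$: (1) $\Psi_t^\chi$ is invertible (as a linear map on $\mathcal{B}(\mathscr{H}_S)$) if and only if $\Phi_t$ is invertible, and in that case $$(\Psi_t^\chi)^{-1}[X]=\Phi_t^{-1}[X]-\Phi_t^{-1}[I_t^\chi]\,\mathrm{Tr}\{X\}\quad\text{for all }X\in\mathcal{B}(\mathscr{H}_S).$$ (2) If $\Phi_t$ is invertible, then with $\mathcal{L}_t:=\dot\Phi_t\circ\Phi_t^{-1}$, the generator $\mathcal{L}_t^\chi:=\dot\Psi_t^\chi\circ(\Psi_t^\chi)^{-1}$ is given by $$\mathcal{L}_t^\chi[X]=\mathcal{L}_t[X]+\mathcal{J}_t^\chi\,\mathrm{Tr}\{X\}\quad\text{for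 all }X\in\mathcal{B}(\mathscr{H}_S),\qquad \mathcal{J}_t^\chi:=\dot I_t^\chi-\mathcal{L}_t[I_t^\chi].$$
   Context: $\mathcal{B}(\mathscr{H}_S)$ is the space of linear operators on $\mathscr{H}_S$. $\mathrm{Tr}_E$ and $\mathrm{Tr}_S$ are the partial traces over $\mathscr{H}_E$ and $\mathscr{H}_S$. A dot denotes the derivative with respect to $t$. *)

theory Defs
  imports "HOL-Analysis.Analysis"
begin

section \<open>Complex Hilbert spaces\<close>

class scaleC = scaleR +
  fixes scaleC :: "complex \<Rightarrow> 'a \<Rightarrow> 'a" (infixr "*\<^sub>C" 75)

class complex_normed_vector = real_normed_vector + scaleC +
  assumes scaleC_add_right: "a *\<^sub>C (x + y) = a *\<^sub>C x + a *\<^sub>C y"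
    and scaleC_add_left: "(a + b) *\<^sub>C x = a *\<^sub>C x + b *\<^sub>C x"
    and scaleC_scaleC: "a *\<^sub>C (b *\<^sub>C x) = (a * b) *\<^sub>C x"
    and scaleR_scaleC: "r *\<^sub>R x = complex_of_real r *\<^sub>C x"
    and norm_scaleC: "norm (a *\<^sub>C x) = cmod a * norm x"

text \<open>The inner product is linear in its second argument. Its real part is the
  inner product of the underlying real space, which fixes the norm.\<close>

class complex_inner = complex_normed_vector + real_inner +
  fixes cinner :: "'a \<Rightarrow> 'a \<Rightarrow> complex"
  assumes cinner_commute: "cinner x y = cnj (cinner y x)"
    and cinner_add_right: "cinner x (y + z) = cinner x y + cinner x z"
    and cinner_scaleC_right: "cinner x (a *\<^sub>C y) = a * cinner x y"
    and Re_cinner: "Re (cinner x y) = inner x y"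

class chilbert_space = complex_inner + complete_space

lemma scaleC_one: "1 *\<^sub>C x = (x :: 'a::complex_normed_vector)"
  using scaleR_scaleC[of 1 x] by simp

interpretation complex_vector:
  vector_space "scaleC :: complex \<Rightarrow> 'a \<Rightarrow> 'a::complex_normed_vector"
  by unfold_locales (simp_all add: scaleC_add_right scaleC_add_left scaleC_scaleC scaleC_one)

abbreviation cspan :: "'a::complex_normed_vector set \<Rightarrow> 'a set"
  where "cspan \<equiv> complex_vector.span"

abbreviation clinear :: "('a::complex_normed_vector \<Rightarrow> 'b::complex_normed_vector) \<Rightarrow> bool"
  where "clinear \<equiv> Vector_Spaces.linear scaleC scaleC"

definition is_onb :: "'a::complex_inner set \<Rightarrow> bool"
  where "is_onb B \<longleftrightarrow>
    (\<forall>x\<in>B. \<forall>y\<in>B. cinner x y = (if x = y then 1 else 0)) \<and> closure (cspan B) = UNIV"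


section \<open>Bounded complex-linear operators\<close>

typedef (overloaded) ('a, 'b) cblinfun ("(_ \<Rightarrow>\<^sub>C\<^sub>L /_)" [22, 21] 21) =
  "{f :: 'a::complex_normed_vector \<Rightarrow>\<^sub>L 'b::complex_normed_vector.
      \<forall>c x. blinfun_apply f (c *\<^sub>C x) = c *\<^sub>C blinfun_apply f x}"
  by (rule exI[of _ 0]) (simp add: complex_vector.scale_zero_right)

setup_lifting type_definition_cblinfun

lift_definition cblinfun_apply ::
  "('a::complex_normed_vector \<Rightarrow>\<^sub>C\<^sub>L 'b::complex_normed_vector) \<Rightarrow> 'a \<Rightarrow> 'b"
  is blinfun_apply .

declare [[coercion cblinfun_apply]]

text \<open>\<open>CBlinfun f\<close> is the operator with underlying function \<open>f\<close>; it is meaningful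
  when \<open>f\<close> is complex-linear and bounded.\<close>

definition CBlinfun ::
  "('a::complex_normed_vector \<Rightarrow> 'b::complex_normed_vector) \<Rightarrow> 'a \<Rightarrow>\<^sub>C\<^sub>L 'b"
  where "CBlinfun f = (THE A. cblinfun_apply A = f)"

lemma cblinfun_eqI: "(\<And>x. cblinfun_apply A x = cblinfun_apply B x) \<Longrightarrow> A = B"
  by transfer (rule blinfun_eqI)

lemma cblinfun_apply_inject: "cblinfun_apply A = cblinfun_apply B \<longleftrightarrow> A = B"
  by (auto intro: cblinfun_eqI)

lemma CBlinfun_inverse:
  assumes "clinear f" and "\<And>x. norm (f x) \<le> norm x * K"
  shows "cblinfun_apply (CBlinfun f) = f"
proof -
  interpret f: Vector_Spaces.linear scaleC scaleC f by fact
  have bl: "bounded_linear f"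
    by (rule bounded_linear_intro[of f K])
      (simp_all add: f.add f.scale scaleR_scaleC assms(2))
  have "cblinfun_apply (Abs_cblinfun (Blinfun f)) = f"
    unfolding cblinfun_apply.rep_eq
    by (subst Abs_cblinfun_inverse) (auto simp: bounded_linear_Blinfun_apply[OF bl] f.scale)
  then have "\<exists>!A. cblinfun_apply A = f"
    by (metis cblinfun_apply_inject)
  then show ?thesis
    unfolding CBlinfun_def by (rule theI')
qed

instantiation cblinfun :: (complex_normed_vector, complex_normed_vector) complex_normed_vector
begin

lift_definition norm_cblinfun :: "'a \<Rightarrow>\<^sub>C\<^sub>L 'b \<Rightarrow> real" is norm .

lift_definition minus_cblinfun :: "'a \<Rightarrow>\<^sub>C\<^sub>L 'b \<Rightarrow> 'a \<Rightarrow>\<^sub>C\<^sub>L 'b \<Rightarrow> 'a \<Rightarrow>\<^sub>C\<^sub>L 'b" is minus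
  by (simp add: blinfun.diff_left complex_vector.scale_right_diff_distrib)

lift_definition plus_cblinfun :: "'a \<Rightarrow>\<^sub>C\<^sub>L 'b \<Rightarrow> 'a \<Rightarrow>\<^sub>C\<^sub>L 'b \<Rightarrow> 'a \<Rightarrow>\<^sub>C\<^sub>L 'b" is plus
  by (simp add: blinfun.add_left scaleC_add_right)

lift_definition uminus_cblinfun :: "'a \<Rightarrow>\<^sub>C\<^sub>L 'b \<Rightarrow> 'a \<Rightarrow>\<^sub>C\<^sub>L 'b" is uminus
  by (simp add: blinfun.minus_left)

lift_definition zero_cblinfun :: "'a \<Rightarrow>\<^sub>C\<^sub>L 'b" is 0
  by simp

lift_definition scaleR_cblinfun :: "real \<Rightarrow> 'a \<Rightarrow>\<^sub>C\<^sub>L 'b \<Rightarrow> 'a \<Rightarrow>\<^sub>C\<^sub>L 'b" is scaleR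
  by (simp add: blinfun.scaleR_left scaleR_scaleC scaleC_scaleC mult.commute)

definition scaleC_cblinfun :: "complex \<Rightarrow> 'a \<Rightarrow>\<^sub>C\<^sub>L 'b \<Rightarrow> 'a \<Rightarrow>\<^sub>C\<^sub>L 'b"
  where "scaleC_cblinfun c A = CBlinfun (\<lambda>x. c *\<^sub>C cblinfun_apply A x)"

definition dist_cblinfun :: "'a \<Rightarrow>\<^sub>C\<^sub>L 'b \<Rightarrow> 'a \<Rightarrow>\<^sub>C\<^sub>L 'b \<Rightarrow> real"
  where "dist_cblinfun A B = norm (A - B)"

definition sgn_cblinfun :: "'a \<Rightarrow>\<^sub>C\<^sub>L 'b \<Rightarrow> 'a \<Rightarrow>\<^sub>C\<^sub>L 'b"
  where "sgn_cblinfun A = scaleR (inverse (norm A)) A"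

definition [code del]:
  "(uniformity :: (('a \<Rightarrow>\<^sub>C\<^sub>L 'b) \<times> ('a \<Rightarrow>\<^sub>C\<^sub>L 'b)) filter) =
    (INF e\<in>{0 <..}. principal {(x, y). dist x y < e})"

definition open_cblinfun :: "('a \<Rightarrow>\<^sub>C\<^sub>L 'b) set \<Rightarrow> bool"
  where [code del]: "open_cblinfun S =
    (\<forall>x\<in>S. \<forall>\<^sub>F (x', y) in uniformity. x' = x \<longrightarrow> y \<in> S)"

instance
proof
  have clin: "clinear (cblinfun_apply A)" for A :: "'a \<Rightarrow>\<^sub>C\<^sub>L 'b"
    by unfold_locales (transfer, simp add: blinfun.add_right, transfer, simp)
  have bnd: "norm (cblinfun_apply A x) \<le> norm x * norm A" for A :: "'a \<Rightarrow>\<^sub>C\<^sub>L 'b" and x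
    by transfer (metis norm_blinfun mult.commute)
  have sc: "cblinfun_apply (c *\<^sub>C A) x = c *\<^sub>C cblinfun_apply A x" for c x and A :: "'a \<Rightarrow>\<^sub>C\<^sub>L 'b"
  proof -
    interpret A: Vector_Spaces.linear scaleC scaleC "cblinfun_apply A" by (rule clin)
    have "clinear (\<lambda>x. c *\<^sub>C cblinfun_apply A x)"
      by unfold_locales (simp_all add: A.add A.scale scaleC_add_right scaleC_scaleC mult.commute)
    moreover have "norm (c *\<^sub>C cblinfun_apply A x) \<le> norm x * (cmod c * norm A)" for x
      using mult_left_mono[OF bnd[of A x] norm_ge_zero[of c]]
      by (simp add: norm_scaleC algebra_simps)
    ultimately show ?thesis
      unfolding scaleC_cblinfun_def by (subst CBlinfun_inverse) auto
  qed
  have pl: "cblinfun_apply (A + B) x = cblinfun_apply A x + cblinfun_apply B x"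
    for A B :: "'a \<Rightarrow>\<^sub>C\<^sub>L 'b" and x by transfer (simp add: blinfun.add_left)
  have sr: "cblinfun_apply (r *\<^sub>R A) x = r *\<^sub>R cblinfun_apply A x"
    for A :: "'a \<Rightarrow>\<^sub>C\<^sub>L 'b" and r x by transfer (simp add: blinfun.scaleR_left)
  fix A B C :: "'a \<Rightarrow>\<^sub>C\<^sub>L 'b" and r s :: real and a b :: complex
  show "dist A B = norm (A - B)" by (rule dist_cblinfun_def)
  show "sgn A = scaleR (inverse (norm A)) A" by (rule sgn_cblinfun_def)
  show "(uniformity :: (('a \<Rightarrow>\<^sub>C\<^sub>L 'b) \<times> ('a \<Rightarrow>\<^sub>C\<^sub>L 'b)) filter) =
      (INF e\<in>{0 <..}. principal {(x, y). dist x y < e})"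
    by (rule uniformity_cblinfun_def)
  show "open S = (\<forall>x\<in>S. \<forall>\<^sub>F (x', y) in uniformity. x' = x \<longrightarrow> y \<in> S)"
    for S :: "('a \<Rightarrow>\<^sub>C\<^sub>L 'b) set" by (rule open_cblinfun_def)
  show "A + B + C = A + (B + C)" by transfer simp
  show "A + B = B + A" by transfer simp
  show "0 + A = A" by transfer simp
  show "- A + A = 0" by transfer simp
  show "A - B = A + - B" by transfer simp
  show "r *\<^sub>R (A + B) = r *\<^sub>R A + r *\<^sub>R B" by transfer (simp add: scaleR_add_right)
  show "(r + s) *\<^sub>R A = r *\<^sub>R A + s *\<^sub>R A" by transfer (simp add: scaleR_add_left)
  show "r *\<^sub>R s *\<^sub>R A = (r * s) *\<^sub>R A" by transfer simp
  show "1 *\<^sub>R A = A" by transfer simp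
  show "(norm A = 0) = (A = 0)" by transfer simp
  show "norm (A + B) \<le> norm A + norm B" by transfer (rule norm_triangle_ineq)
  show "norm (r *\<^sub>R A) = \<bar>r\<bar> * norm A" by transfer simp
  show "a *\<^sub>C (A + B) = a *\<^sub>C A + a *\<^sub>C B"
    by (rule cblinfun_eqI) (simp add: sc pl scaleC_add_right)
  show "(a + b) *\<^sub>C A = a *\<^sub>C A + b *\<^sub>C A"
    by (rule cblinfun_eqI) (simp add: sc pl scaleC_add_left)
  show "a *\<^sub>C (b *\<^sub>C A) = (a * b) *\<^sub>C A"
    by (rule cblinfun_eqI) (simp add: sc scaleC_scaleC)
  show "r *\<^sub>R A = complex_of_real r *\<^sub>C A"
    by (rule cblinfun_eqI) (simp add: sc sr scaleR_scaleC)
  show "norm (a *\<^sub>C A) = cmod a * norm A"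
  proof -
    have up: "norm (c *\<^sub>C D) \<le> cmod c * norm D" for c and D :: "'a \<Rightarrow>\<^sub>C\<^sub>L 'b"
    proof -
      have "norm (Rep_cblinfun (c *\<^sub>C D)) \<le> cmod c * norm (Rep_cblinfun D)"
      proof (rule norm_blinfun_bound)
        fix x
        show "norm (blinfun_apply (Rep_cblinfun (c *\<^sub>C D)) x) \<le> cmod c * norm (Rep_cblinfun D) * norm x"
          using sc[of c D x] mult_left_mono[OF norm_blinfun[of "Rep_cblinfun D" x] norm_ge_zero[of c]]
          by (simp add: cblinfun_apply.rep_eq norm_scaleC algebra_simps)
      qed simp
      then show ?thesis by (simp add: norm_cblinfun.rep_eq)
    qed
    show ?thesis
    proof (cases "a = 0")
      case True
      then show ?thesis using up[of a A] by (simp add: norm_cblinfun.rep_eq)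
    next
      case False
      have "inverse a *\<^sub>C (a *\<^sub>C A) = A"
        by (rule cblinfun_eqI) (simp add: sc scaleC_scaleC scaleC_one False)
      then have "norm A \<le> cmod (inverse a) * norm (a *\<^sub>C A)"
        using up[of "inverse a" "a *\<^sub>C A"] by simp
      then have "cmod a * norm A \<le> norm (a *\<^sub>C A)"
        using False unfolding norm_inverse by (simp add: field_simps)
      then show ?thesis using up[of a A] by simp
    qed
  qed
qed

end

lift_definition id_cblinfun :: "'a::complex_normed_vector \<Rightarrow>\<^sub>C\<^sub>L 'a" is id_blinfun
  by simp

lift_definition cblinfun_compose ::
  "('b::complex_normed_vector \<Rightarrow>\<^sub>C\<^sub>L 'c::complex_normed_vector) \<Rightarrow>
   ('a::complex_normed_vector \<Rightarrow>\<^sub>C\<^sub>L 'b) \<Rightarrow> 'a \<Rightarrow>\<^sub>C\<^sub>L 'c" (infixl "o\<^sub>C" 67)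
  is blinfun_compose
  by simp

definition adj ::
  "('a::chilbert_space \<Rightarrow>\<^sub>C\<^sub>L 'b::chilbert_space) \<Rightarrow> 'b \<Rightarrow>\<^sub>C\<^sub>L 'a"
  where "adj A = (THE B :: 'b \<Rightarrow>\<^sub>C\<^sub>L 'a. \<forall>x y. cinner (A x) y = cinner x (B y))"

definition hermitian :: "('a::chilbert_space \<Rightarrow>\<^sub>C\<^sub>L 'a) \<Rightarrow> bool"
  where "hermitian A \<longleftrightarrow> adj A = A"

definition unitary :: "('a::chilbert_space \<Rightarrow>\<^sub>C\<^sub>L 'a) \<Rightarrow> bool"
  where "unitary A \<longleftrightarrow> adj A o\<^sub>C A = id_cblinfun \<and> A o\<^sub>C adj A = id_cblinfun"

definition positive_op :: "('a::chilbert_space \<Rightarrow>\<^sub>C\<^sub>L 'a) \<Rightarrow> bool"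
  where "positive_op A \<longleftrightarrow> (\<forall>x. cinner x (A x) \<in> \<real>\<^sub>\<ge>\<^sub>0)"


section \<open>Trace and trace class\<close>

text \<open>In the next definition \<open>P\<close> is the absolute value of \<open>A\<close>, that is, the (unique)
  positive square root of \<open>adj A o\<^sub>C A\<close>.\<close>

definition trace_class :: "('a::chilbert_space \<Rightarrow>\<^sub>C\<^sub>L 'a) \<Rightarrow> bool"
  where "trace_class A \<longleftrightarrow>
    (\<exists>P B. positive_op P \<and> P o\<^sub>C P = adj A o\<^sub>C A \<and>
       is_onb B \<and> (\<lambda>e. cinner e (P e)) summable_on B)"

definition tr :: "('a::chilbert_space \<Rightarrow>\<^sub>C\<^sub>L 'a) \<Rightarrow> complex"
  where "tr A = (THE z. \<forall>B. is_onb B \<longrightarrow> ((\<lambda>e. cinner e (A e)) has_sum z) B)"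

definition density_op :: "('a::chilbert_space \<Rightarrow>\<^sub>C\<^sub>L 'a) \<Rightarrow> bool"
  where "density_op A \<longleftrightarrow> positive_op A \<and> trace_class A \<and> tr A = 1"


section \<open>Tensor products and partial traces\<close>

text \<open>\<open>is_tensor tens\<close> says that the space \<open>'k\<close> together with \<open>tens\<close> is the Hilbert space
  tensor product of \<open>'s\<close> and \<open>'e\<close>, where \<open>tens x y\<close> is the elementary tensor of
  \<open>x\<close> and \<open>y\<close>. These conditions determine \<open>('k, tens)\<close> up to a unique unitary.\<close>

definition is_tensor ::
  "('s::chilbert_space \<Rightarrow> 'e::chilbert_space \<Rightarrow> 'k::chilbert_space) \<Rightarrow> bool"
  where "is_tensor tens \<longleftrightarrow>
    (\<forall>y. clinear (\<lambda>x. tens x y)) \<and> (\<forall>x. clinear (\<lambda>y. tens x y)) \<and>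
    (\<forall>x y x' y'. cinner (tens x y) (tens x' y') = cinner x x' * cinner y y') \<and>
    closure (cspan {tens x y | x y. True}) = UNIV"

definition op_tensor ::
  "('s::chilbert_space \<Rightarrow> 'e::chilbert_space \<Rightarrow> 'k::chilbert_space) \<Rightarrow>
   ('s \<Rightarrow>\<^sub>C\<^sub>L 's) \<Rightarrow> ('e \<Rightarrow>\<^sub>C\<^sub>L 'e) \<Rightarrow> 'k \<Rightarrow>\<^sub>C\<^sub>L 'k"
  where "op_tensor tens X Y = (THE Z :: 'k \<Rightarrow>\<^sub>C\<^sub>L 'k. \<forall>x y. Z (tens x y) = tens (X x) (Y y))"

definition ptrace_E ::
  "('s::chilbert_space \<Rightarrow> 'e::chilbert_space \<Rightarrow> 'k::chilbert_space) \<Rightarrow>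
   ('k \<Rightarrow>\<^sub>C\<^sub>L 'k) \<Rightarrow> 's \<Rightarrow>\<^sub>C\<^sub>L 's"
  where "ptrace_E tens A = (THE T :: 's \<Rightarrow>\<^sub>C\<^sub>L 's. \<forall>B. is_onb B \<longrightarrow> (\<forall>x x'.
    ((\<lambda>e. cinner (tens x e) (A (tens x' e))) has_sum cinner x (T x')) B))"

definition ptrace_S ::
  "('s::chilbert_space \<Rightarrow> 'e::chilbert_space \<Rightarrow> 'k::chilbert_space) \<Rightarrow>
   ('k \<Rightarrow>\<^sub>C\<^sub>L 'k) \<Rightarrow> 'e \<Rightarrow>\<^sub>C\<^sub>L 'e"
  where "ptrace_S tens A = (THE T :: 'e \<Rightarrow>\<^sub>C\<^sub>L 'e. \<forall>B. is_onb B \<longrightarrow> (\<forall>y y'.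
    ((\<lambda>s. cinner (tens s y) (A (tens s y'))) has_sum cinner y (T y')) B))"


section \<open>Reduced dynamics\<close>

definition Phi ::
  "('s::chilbert_space \<Rightarrow> 'e::chilbert_space \<Rightarrow> 'k::chilbert_space) \<Rightarrow>
   (real \<Rightarrow> 'k \<Rightarrow>\<^sub>C\<^sub>L 'k) \<Rightarrow> ('e \<Rightarrow>\<^sub>C\<^sub>L 'e) \<Rightarrow> real \<Rightarrow> ('s \<Rightarrow>\<^sub>C\<^sub>L 's) \<Rightarrow>\<^sub>C\<^sub>L ('s \<Rightarrow>\<^sub>C\<^sub>L 's)"
  where "Phi tens U \<rho> t =
    CBlinfun (\<lambda>X. ptrace_E tens (U t o\<^sub>C op_tensor tens X \<rho> o\<^sub>C adj (U t)))"

definition Icorr ::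
  "('s::chilbert_space \<Rightarrow> 'e::chilbert_space \<Rightarrow> 'k::chilbert_space) \<Rightarrow>
   (real \<Rightarrow> 'k \<Rightarrow>\<^sub>C\<^sub>L 'k) \<Rightarrow> ('k \<Rightarrow>\<^sub>C\<^sub>L 'k) \<Rightarrow> real \<Rightarrow> 's \<Rightarrow>\<^sub>C\<^sub>L 's"
  where "Icorr tens U chi t = ptrace_E tens (U t o\<^sub>C chi o\<^sub>C adj (U t))"

definition Psi ::
  "('s::chilbert_space \<Rightarrow> 'e::chilbert_space \<Rightarrow> 'k::chilbert_space) \<Rightarrow>
   (real \<Rightarrow> 'k \<Rightarrow>\<^sub>C\<^sub>L 'k) \<Rightarrow> ('e \<Rightarrow>\<^sub>C\<^sub>L 'e) \<Rightarrow> ('k \<Rightarrow>\<^sub>C\<^sub>L 'k) \<Rightarrow> real \<Rightarrow> ('s \<Rightarrow>\<^sub>C\<^sub>L 's) \<Rightarrow>\<^sub>C\<^sub>L ('s \<Rightarrow>\<^sub>C\<^sub>L 's)"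
  where "Psi tens U \<rho> chi t =
    CBlinfun (\<lambda>X. Phi tens U \<rho> t X + tr X *\<^sub>C Icorr tens U chi t)"

text \<open>The time domain is the half-line \<open>t \<ge> 0\<close>, so the derivative at \<open>0\<close> is one-sided.\<close>

definition tderiv :: "(real \<Rightarrow> 'a::real_normed_vector) \<Rightarrow> real \<Rightarrow> 'a"
  where "tderiv f t = vector_derivative f (at t within {0..})"

definition generator ::
  "(real \<Rightarrow> 'a::complex_normed_vector \<Rightarrow>\<^sub>C\<^sub>L 'a) \<Rightarrow> real \<Rightarrow> 'a \<Rightarrow> 'a"
  where "generator F t = cblinfun_apply (tderiv F t) \<circ> inv (cblinfun_apply (F t))"

end

theory Submission
  imports Defs
begin

text \<open>The map \<open>Phi\<close> preserves the trace and \<open>Icorr\<close> has trace \<open>0\<close>, so \<open>Psi\<close> is the perturbation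
  \<open>Phi + tr (_) Icorr\<close> by a functional that \<open>Phi\<close> leaves invariant and that vanishes on \<open>Icorr\<close>;
  inverse and generator follow by linear algebra. The two trace identities rest on the existence
  and basis independence of traces and partial traces. A trace-class \<open>A\<close> satisfies
  \<open>\<parallel>A x\<parallel> = \<parallel>S (S x)\<parallel>\<close> with \<open>S\<close> the square root of \<open>|A|\<close>, hence \<open>A = (V S) S\<close> with \<open>V\<close> bounded and
  both factors Hilbert-Schmidt; polarization expresses the diagonal sums of a product of two
  Hilbert-Schmidt operators through Hilbert-Schmidt norms, which do not depend on the basis by
  Parseval's identity.\<close>

section \<open>Inner products and operators\<close>

text \<open>The shape is dictated by the definitions. \<open>adj\<close>, \<open>tr\<close>,
  \<open>op_tensor\<close> and \<open>ptrace_E\<close> are definite descriptions and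
  \<open>Phi\<close> is a \<open>CBlinfun\<close>, so nothing can be computed with them before
  existence and uniqueness are known and, for \<open>Phi\<close>, linearity and a bound. The
  relations \<open>has_trace\<close> and \<open>is_ptrace\<close> carry the argument up to that
  point. A second obstacle: \<open>trace_class\<close> supplies summability of \<open>|A|\<close> in
  a single basis, while \<open>tr\<close> and \<open>ptrace_E\<close> ask for the same sum of
  \<open>A\<close> itself in every basis, over an environment of arbitrary dimension. Even the
  existence of a basis of the environment is read off from the \<open>trace_class\<close> witness
  for \<open>\<rho>\<close>. Finite dimension of the system turns operators on the tensor product
  into finite sums of operators factoring through the environment, so no extension by continuity is
  required. The converse in (1) is the same perturbation argument, applied to \<open>Phi\<close> as
  \<open>Psi\<close> perturbed by \<open>- Icorr\<close>.\<close>

instance chilbert_space \<subseteq> banach ..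

lemma cinner_add_left: "cinner (x + y) z = cinner x z + cinner (y::'a::complex_inner) z"
  by (metis cinner_add_right cinner_commute complex_cnj_add)

lemma cinner_scaleC_left: "cinner (a *\<^sub>C x) y = cnj a * cinner x (y::'a::complex_inner)"
  by (metis cinner_scaleC_right cinner_commute complex_cnj_mult)

lemma cinner_zero_right [simp]: "cinner x (0::'a::complex_inner) = 0"
  using cinner_add_right[of x 0 0] by simp

lemma cinner_zero_left [simp]: "cinner (0::'a::complex_inner) x = 0"
  using cinner_add_left[of 0 0 x] by simp

lemma cinner_minus_right: "cinner x (- y) = - cinner x (y::'a::complex_inner)"
  using cinner_add_right[of x y "- y"] by (simp add: add_eq_0_iff)

lemma cinner_minus_left: "cinner (- x) y = - cinner x (y::'a::complex_inner)"
  using cinner_add_left[of x "- x" y] by (simp add: add_eq_0_iff)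

lemma cinner_diff_right: "cinner x (y - z) = cinner x y - cinner x (z::'a::complex_inner)"
  using cinner_add_right[of x y "- z"] by (simp add: cinner_minus_right)

lemma cinner_diff_left: "cinner (x - y) z = cinner x z - cinner y (z::'a::complex_inner)"
  using cinner_add_left[of x "- y" z] by (simp add: cinner_minus_left)

lemma cinner_scaleR_right: "cinner x (r *\<^sub>R y) = of_real r * cinner x (y::'a::complex_inner)"
  by (simp add: scaleR_scaleC cinner_scaleC_right)

lemma cinner_scaleR_left: "cinner (r *\<^sub>R x) y = of_real r * cinner x (y::'a::complex_inner)"
  by (simp add: scaleR_scaleC cinner_scaleC_left)

lemma cinner_sum_right: "cinner x (\<Sum>i\<in>I. f i) = (\<Sum>i\<in>I. cinner x (f i :: 'a::complex_inner))"
  by (induction I rule: infinite_finite_induct) (simp_all add: cinner_add_right)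

lemma cinner_sum_left: "cinner (\<Sum>i\<in>I. f i) x = (\<Sum>i\<in>I. cinner (f i :: 'a::complex_inner) x)"
  by (induction I rule: infinite_finite_induct) (simp_all add: cinner_add_left)

lemma cinner_self: "cinner x x = of_real ((norm (x::'a::complex_inner))\<^sup>2)"
proof -
  have "Im (cinner x x) = 0"
    using cinner_commute[of x x] by (metis complex_cnj_cancel_iff complex_is_Real_iff Reals_cnj_iff)
  then show ?thesis
    by (simp add: complex_eq_iff Re_cinner power2_norm_eq_inner)
qed

lemma cmod_eq_Re_phase: "\<exists>c. cmod c = 1 \<and> c * z = complex_of_real (cmod z)"
proof (cases "z = 0")
  case False
  then have "cmod (cnj z / of_real (cmod z)) = 1"
    by (simp add: norm_divide)
  moreover have "cnj z / of_real (cmod z) * z = of_real (cmod z)"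
    using False complex_norm_square[of z]
    by (simp add: field_simps power2_eq_square)
  ultimately show ?thesis by blast
qed (auto intro: exI[of _ 1])

text \<open>Rotating \<open>y\<close> by a phase makes the inner product real and nonnegative, so
  the real Cauchy-Schwarz inequality loses nothing.\<close>

lemma cinner_cauchy_schwarz: "cmod (cinner x y) \<le> norm x * norm (y::'a::complex_inner)"
proof -
  obtain c where c: "cmod c = 1" "c * cinner x y = of_real (cmod (cinner x y))"
    using cmod_eq_Re_phase by blast
  have "cmod (cinner x y) = Re (cinner x (c *\<^sub>C y))"
    by (simp add: cinner_scaleC_right c)
  also have "\<dots> \<le> norm x * norm (c *\<^sub>C y)"
    unfolding Re_cinner by (rule norm_cauchy_schwarz)
  finally show ?thesis by (simp add: norm_scaleC c)
qed

lemma bounded_bilinear_cinner: "bounded_bilinear (cinner :: 'a::complex_inner \<Rightarrow> 'a \<Rightarrow> complex)"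
  by (intro bounded_bilinear.intro exI[of _ 1])
    (simp_all add: cinner_add_left cinner_add_right cinner_scaleR_left cinner_scaleR_right
      scaleR_conv_of_real cinner_cauchy_schwarz)

lemmas tendsto_cinner [tendsto_intros] = bounded_bilinear.tendsto[OF bounded_bilinear_cinner]

lemma cinner_ext: "(\<And>x. cinner x y = cinner x z) \<Longrightarrow> y = (z::'a::complex_inner)"
  by (metis cinner_diff_right cinner_self eq_iff_diff_eq_0 norm_eq_zero of_real_eq_0_iff
      power_eq_0_iff)

lemma cnorm_add_square:
  "(norm (x + y))\<^sup>2 = (norm x)\<^sup>2 + (norm (y::'a::complex_inner))\<^sup>2 + 2 * Re (cinner x y)"
  by (simp add: Re_cinner power2_norm_eq_inner inner_add_left inner_add_right inner_commute)

section \<open>Algebra and completeness of bounded complex-linear operators\<close>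

lemma bounded_linear_scaleC_right: "bounded_linear (\<lambda>x::'a::complex_normed_vector. c *\<^sub>C x)"
  by (rule bounded_linear_intro[of _ "cmod c"])
    (simp_all add: scaleC_add_right scaleR_scaleC scaleC_scaleC norm_scaleC mult.commute)

lemma cblinfun_add_right: "cblinfun_apply A (x + y) = A x + A y"
  by transfer (simp add: blinfun.add_right)

lemma cblinfun_scaleC_right: "cblinfun_apply A (c *\<^sub>C x) = c *\<^sub>C A x"
  by transfer simp

lemma clinear_cblinfun: "clinear (cblinfun_apply A)"
  by unfold_locales (simp_all add: cblinfun_add_right cblinfun_scaleC_right)

lemma bounded_linear_cblinfun: "bounded_linear (cblinfun_apply A)"
  by transfer (rule blinfun.bounded_linear_right)

lemma cblinfun_zero_right [simp]: "cblinfun_apply A 0 = 0"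
  by (rule bounded_linear.linear[OF bounded_linear_cblinfun, THEN linear_0])

lemma cblinfun_diff_right: "cblinfun_apply A (x - y) = A x - A y"
  by (rule bounded_linear.linear[OF bounded_linear_cblinfun, THEN linear_diff])

lemma cblinfun_sum_right: "cblinfun_apply A (\<Sum>i\<in>I. f i) = (\<Sum>i\<in>I. A (f i))"
  by (rule bounded_linear.linear[OF bounded_linear_cblinfun, THEN linear_sum])

lemma norm_cblinfun_bound: "norm (cblinfun_apply A x) \<le> norm A * norm x"
  by transfer (rule norm_blinfun)

lemma norm_cblinfun_le: "0 \<le> b \<Longrightarrow> (\<And>x. norm (cblinfun_apply A x) \<le> b * norm x) \<Longrightarrow> norm A \<le> b"
  by transfer (rule norm_blinfun_bound)

lemma cblinfun_add_left [simp]: "cblinfun_apply (A + B) x = A x + B x"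
  by transfer (simp add: blinfun.add_left)

lemma cblinfun_diff_left [simp]: "cblinfun_apply (A - B) x = A x - B x"
  by transfer (simp add: blinfun.diff_left)

lemma cblinfun_zero_left [simp]: "cblinfun_apply 0 x = 0"
  by transfer simp

lemma cblinfun_scaleR_left [simp]: "cblinfun_apply (r *\<^sub>R A) x = r *\<^sub>R A x"
  by transfer (simp add: blinfun.scaleR_left)

lemma cblinfun_id_apply [simp]: "cblinfun_apply id_cblinfun x = x"
  by transfer simp

lemma cblinfun_compose_apply [simp]: "cblinfun_apply (A o\<^sub>C B) x = A (B x)"
  by transfer simp

lemma CBlinfun_apply:
  assumes "\<And>x y. f (x + y) = f x + f y" "\<And>c x. f (c *\<^sub>C x) = c *\<^sub>C f x"
    and "\<And>x. norm (f x) \<le> K * norm x"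
  shows "cblinfun_apply (CBlinfun f) x = f x"
proof -
  have "clinear f"
    by unfold_locales (simp_all add: assms)
  then show ?thesis
    using CBlinfun_inverse[of f K] assms(3) by (simp add: mult.commute)
qed

lemma cblinfun_scaleC_left [simp]: "cblinfun_apply (c *\<^sub>C A) x = c *\<^sub>C A x"
  unfolding scaleC_cblinfun_def
proof (rule CBlinfun_apply)
  show "norm (c *\<^sub>C A x) \<le> (cmod c * norm A) * norm x" for x
    using mult_left_mono[OF norm_cblinfun_bound[of A x] norm_ge_zero[of c]]
    by (simp add: norm_scaleC mult_ac)
qed (simp_all add: cblinfun_add_right cblinfun_scaleC_right scaleC_add_right scaleC_scaleC mult.commute)

lemma cblinfun_sum_left: "cblinfun_apply (\<Sum>i\<in>I. A i) x = (\<Sum>i\<in>I. A i x)"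
  by (induction I rule: infinite_finite_induct) simp_all

lemma norm_cblinfun_compose_le: "norm (A o\<^sub>C B) \<le> norm A * norm B"
  by transfer (rule norm_blinfun_compose)

lemma bounded_bilinear_cblinfun_compose:
  "bounded_bilinear (cblinfun_compose ::
    ('b::complex_normed_vector \<Rightarrow>\<^sub>C\<^sub>L 'a::complex_normed_vector) \<Rightarrow>
    ('c::complex_normed_vector \<Rightarrow>\<^sub>C\<^sub>L 'b) \<Rightarrow> _)"
proof
  show "\<exists>K. \<forall>(A::'b \<Rightarrow>\<^sub>C\<^sub>L 'a) (B::'c \<Rightarrow>\<^sub>C\<^sub>L 'b). norm (A o\<^sub>C B) \<le> norm A * norm B * K"
    by (rule exI[of _ 1]) (simp add: norm_cblinfun_compose_le)
qed (rule cblinfun_eqI, simp add: cblinfun_add_right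
    linear_scale[OF bounded_linear.linear[OF bounded_linear_cblinfun]])+

lemma bounded_linear_cblinfun_apply_left: "bounded_linear (\<lambda>A. cblinfun_apply A x)"
  by (rule bounded_linear_intro[of _ "norm x"]) (simp_all add: norm_cblinfun_bound)

text \<open>The limit exists among the real-linear operators, and complex linearity passes to
  pointwise limits. Completeness is what makes the square root iteration converge.\<close>

instance cblinfun :: (complex_normed_vector, chilbert_space) banach
proof
  fix X :: "nat \<Rightarrow> 'a \<Rightarrow>\<^sub>C\<^sub>L 'b"
  assume "Cauchy X"
  then have "Cauchy (\<lambda>n. Rep_cblinfun (X n))"
    unfolding Cauchy_iff by (simp add: norm_cblinfun.rep_eq minus_cblinfun.rep_eq)
  then obtain L where L: "(\<lambda>n. Rep_cblinfun (X n)) \<longlonglongrightarrow> L"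
    by (auto simp: Cauchy_convergent_iff convergent_def)
  have lim: "(\<lambda>n. blinfun_apply (Rep_cblinfun (X n)) x) \<longlonglongrightarrow> blinfun_apply L x" for x
    by (intro tendsto_intros L)
  have "blinfun_apply L (c *\<^sub>C x) = c *\<^sub>C blinfun_apply L x" for c x
  proof (rule LIMSEQ_unique[OF lim])
    have "(\<lambda>n. c *\<^sub>C blinfun_apply (Rep_cblinfun (X n)) x) \<longlonglongrightarrow> c *\<^sub>C blinfun_apply L x"
      by (rule bounded_linear.tendsto[OF bounded_linear_scaleC_right lim])
    then show "(\<lambda>n. blinfun_apply (Rep_cblinfun (X n)) (c *\<^sub>C x)) \<longlonglongrightarrow> c *\<^sub>C blinfun_apply L x"
      using cblinfun_scaleC_right[of "X _" c x] by (simp add: cblinfun_apply.rep_eq)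
  qed
  then have L': "Rep_cblinfun (Abs_cblinfun L) = L"
    by (simp add: Abs_cblinfun_inverse)
  have "X \<longlonglongrightarrow> Abs_cblinfun L"
    using L unfolding LIMSEQ_iff by (simp add: norm_cblinfun.rep_eq minus_cblinfun.rep_eq L')
  then show "convergent X"
    by (auto simp: convergent_def)
qed

section \<open>Adjoints\<close>

text \<open>Riesz representation by minimization. If \<open>f x = cinner z (P x)\<close>, then
  \<open>J x\<close> is the squared distance from \<open>P x\<close> to \<open>z\<close>, less the
  constant \<open>(norm z)\<^sup>2\<close>. Hence the images under \<open>P\<close> of a minimizing
  sequence must converge to the vector sought, which therefore lies in the closure of the range of
  \<open>P\<close>.\<close>

lemma riesz_range:
  fixes f :: "'a::complex_normed_vector \<Rightarrow> complex"
    and P :: "'a \<Rightarrow>\<^sub>C\<^sub>L 'b::chilbert_space"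
  assumes f_add: "\<And>x y. f (x + y) = f x + f y" and f_scale: "\<And>c x. f (c *\<^sub>C x) = c * f x"
    and bound: "\<And>x. cmod (f x) \<le> K * norm (P x)" and K: "K \<ge> 0"
  shows "\<exists>z xs. (\<lambda>n. P (xs n)) \<longlonglongrightarrow> z \<and> (\<forall>x. f x = cinner z (P x)) \<and> norm z \<le> K"
proof -
  define J where "J x = (norm (P x))\<^sup>2 - 2 * Re (f x)" for x
  have f_scaleR: "f (r *\<^sub>R x) = of_real r * f x" for r x
    by (simp add: scaleR_scaleC f_scale)
  note P_scaleR = linear_scale[OF bounded_linear.linear[OF bounded_linear_cblinfun[of P]]]
  have J_lower: "J x \<ge> - K\<^sup>2" for x
  proof -
    have "Re (f x) \<le> K * norm (P x)"
      using bound[of x] complex_Re_le_cmod[of "f x"] by linarith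
    moreover have "0 \<le> (norm (P x) - K)\<^sup>2" by simp
    ultimately show ?thesis
      unfolding J_def by (simp add: power2_diff algebra_simps)
  qed
  define m where "m = Inf (range J)"
  have bdd: "bdd_below (range J)"
    using J_lower by (meson bdd_belowI2)
  have m_le: "m \<le> J x" for x
    unfolding m_def by (rule cInf_lower[OF rangeI bdd])
  have "\<exists>x. J x < m + 1 / real (Suc n)" for n
    using cInf_lessD[of "range J" "m + 1 / real (Suc n)"] unfolding m_def by auto
  then obtain xs where xs: "\<And>n. J (xs n) < m + 1 / real (Suc n)"
    by metis
  \<comment> \<open>The parallelogram law: the contributions of \<open>f\<close> cancel by
    additivity, and the value of \<open>J\<close> at the midpoint is at least
    \<open>m\<close>.\<close>
  have gap: "(norm (P (xs i) - P (xs j)))\<^sup>2 \<le> 2 / real (Suc i) + 2 / real (Suc j)" for i j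
  proof -
    let ?h = "(1/2) *\<^sub>R (xs i + xs j)"
    have "(norm (P (xs i) - P (xs j)))\<^sup>2 = 2 * J (xs i) + 2 * J (xs j) - 4 * J ?h"
      unfolding J_def
      by (simp add: P_scaleR f_scaleR cblinfun_add_right f_add power_mult_distrib power2_norm_eq_inner
          inner_add_left inner_add_right inner_diff_left inner_diff_right inner_commute
          field_simps)
    then show ?thesis
      using xs[of i] xs[of j] m_le[of ?h] by linarith
  qed
  have "Cauchy (\<lambda>n. P (xs n))"
  proof (rule CauchyI)
    fix e :: real assume e: "e > 0"
    obtain N where N: "4 / real (Suc N) < e\<^sup>2"
      using reals_Archimedean[of "e\<^sup>2 / 4"] e by (auto simp: field_simps)
    have "norm (P (xs i) - P (xs j)) < e" if "i \<ge> N" "j \<ge> N" for i j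
    proof -
      have "2 / real (Suc i) \<le> 2 / real (Suc N)" "2 / real (Suc j) \<le> 2 / real (Suc N)"
        using that by (simp_all add: frac_le)
      then have "(norm (P (xs i) - P (xs j)))\<^sup>2 < e\<^sup>2"
        using gap[of i j] N by simp
      then show ?thesis
        using e by (meson less_eq_real_def power2_less_imp_less)
    qed
    then show "\<exists>M. \<forall>i\<ge>M. \<forall>j\<ge>M. norm (P (xs i) - P (xs j)) < e" by blast
  qed
  then obtain z where z: "(\<lambda>n. P (xs n)) \<longlonglongrightarrow> z"
    by (auto simp: Cauchy_convergent_iff convergent_def)
  have J_lim: "(\<lambda>n. J (xs n)) \<longlonglongrightarrow> m"
  proof (rule tendsto_sandwich[of "\<lambda>_. m" _ _ "\<lambda>n. m + 1 / real (Suc n)"])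
    show "(\<lambda>n. m + 1 / real (Suc n)) \<longlonglongrightarrow> m"
      using tendsto_add[OF tendsto_const[of m] LIMSEQ_inverse_real_of_nat]
      by (simp add: inverse_eq_divide)
    show "(\<lambda>n. m) \<longlonglongrightarrow> m" by simp
    show "\<forall>\<^sub>F n in sequentially. m \<le> J (xs n)"
      by (intro always_eventually allI m_le)
    show "\<forall>\<^sub>F n in sequentially. J (xs n) \<le> m + 1 / real (Suc n)"
      by (intro always_eventually allI less_imp_le xs)
  qed
  have Re_eq: "Re (f h) = Re (cinner z (P h))" for h
  proof -
    let ?a = "Re (cinner z (P h)) - Re (f h)"
    have quad: "0 \<le> 2 * t * ?a + t\<^sup>2 * (norm (P h))\<^sup>2" for t
    proof -
      have "(\<lambda>n. J (xs n) + 2 * t * (inner (P (xs n)) (P h) - Re (f h)) + t\<^sup>2 * (norm (P h))\<^sup>2)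
          \<longlonglongrightarrow> m + 2 * t * (inner z (P h) - Re (f h)) + t\<^sup>2 * (norm (P h))\<^sup>2"
        by (intro tendsto_intros J_lim z)
      moreover have "m \<le> J (xs n) + 2 * t * (inner (P (xs n)) (P h) - Re (f h)) + t\<^sup>2 * (norm (P h))\<^sup>2"
        for n
      proof -
        have "J (xs n + t *\<^sub>R h) =
            J (xs n) + 2 * t * (inner (P (xs n)) (P h) - Re (f h)) + t\<^sup>2 * (norm (P h))\<^sup>2"
          unfolding J_def
          by (simp add: P_scaleR f_scaleR cblinfun_add_right f_add power2_norm_eq_inner
              inner_add_left inner_add_right inner_commute algebra_simps power2_eq_square[of t])
        then show ?thesis
          using m_le[of "xs n + t *\<^sub>R h"] by simp
      qed
      ultimately have "m \<le> m + 2 * t * (inner z (P h) - Re (f h)) + t\<^sup>2 * (norm (P h))\<^sup>2"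
        by (intro LIMSEQ_le_const) auto
      then show ?thesis
        by (simp add: Re_cinner)
    qed
    \<comment> \<open>The quadratic in \<open>t\<close> is smallest near
      \<open>- ?a / (norm (P h))\<^sup>2\<close>. Adding 1 to the denominator covers
      \<open>P h = 0\<close> and still gives a negative value unless \<open>?a = 0\<close>.\<close>
    define b where "b = (norm (P h))\<^sup>2 + 1"
    have b: "b > 0" unfolding b_def by (simp add: add_nonneg_pos)
    have "0 \<le> 2 * (- ?a / b) * ?a + (- ?a / b)\<^sup>2 * (b - 1)"
      using quad[of "- ?a / b"] by (simp add: b_def)
    also have "\<dots> = - ?a\<^sup>2 * (b + 1) / b\<^sup>2"
      using b by (simp add: field_simps power2_eq_square)
    finally have "?a\<^sup>2 * (b + 1) \<le> 0"
      using b by (simp add: field_simps)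
    then have "?a = 0"
      using b by (simp add: mult_le_0_iff)
    then show ?thesis by simp
  qed
  have f_eq: "f h = cinner z (P h)" for h
  proof (rule complex_eqI)
    show "Im (f h) = Im (cinner z (P h))"
      using Re_eq[of "\<i> *\<^sub>C h"]
      by (simp add: f_scale cblinfun_scaleC_right cinner_scaleC_right)
  qed (rule Re_eq)
  \<comment> \<open>Testing the bound on the minimizing sequence itself gives the norm estimate for
    \<open>z\<close> in the limit.\<close>
  have "(\<lambda>n. cmod (cinner z (P (xs n)))) \<longlonglongrightarrow> cmod (cinner z z)"
    by (intro tendsto_intros z)
  moreover have "(\<lambda>n. K * norm (P (xs n))) \<longlonglongrightarrow> K * norm z"
    by (intro tendsto_intros z)
  ultimately have "cmod (cinner z z) \<le> K * norm z"
    by (rule LIMSEQ_le) (use bound f_eq in auto)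
  then have "norm z * norm z \<le> K * norm z"
    by (simp add: cinner_self power2_eq_square norm_mult)
  then have "norm z \<le> K"
    using K by (cases "z = 0") auto
  then show ?thesis
    using z f_eq by blast
qed

text \<open>Here \<open>W\<close> is the adjoint of an operator \<open>V\<close> with \<open>A = V o P\<close>; for \<open>P = id\<close> it is
  the adjoint of \<open>A\<close>. One lemma thus yields adjoints and the factorization of trace-class
  operators.\<close>

lemma douglas:
  fixes A :: "'a::complex_normed_vector \<Rightarrow>\<^sub>C\<^sub>L 'c::chilbert_space"
    and P :: "'a \<Rightarrow>\<^sub>C\<^sub>L 'b::chilbert_space"
  assumes bound: "\<And>x. norm (A x) \<le> K * norm (P x)" and K: "K \<ge> 0"
  shows "\<exists>W :: 'c \<Rightarrow>\<^sub>C\<^sub>L 'b. \<forall>x y. cinner y (A x) = cinner (W y) (P x)"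
proof -
  \<comment> \<open>Membership in the closure of the range of \<open>P\<close> makes the
    representing vector unique, since a difference of two candidates is orthogonal to the range and
    a limit of points of it. Uniqueness is what makes \<open>w\<close> linear.\<close>
  define in_cl where "in_cl z \<longleftrightarrow> (\<exists>xs. (\<lambda>n. P (xs n)) \<longlonglongrightarrow> z)" for z
  have cl_add: "in_cl (a + b)" if a: "in_cl a" and b: "in_cl b" for a b
  proof -
    obtain xs where xs: "(\<lambda>n. P (xs n)) \<longlonglongrightarrow> a"
      using a unfolding in_cl_def by (rule exE)
    obtain ys where "(\<lambda>n. P (ys n)) \<longlonglongrightarrow> b"
      using b unfolding in_cl_def by (rule exE)
    with xs have "(\<lambda>n. P (xs n + ys n)) \<longlonglongrightarrow> a + b"
      by (simp add: cblinfun_add_right tendsto_add)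
    then show ?thesis unfolding in_cl_def by (rule exI[of _ "\<lambda>n. xs n + ys n"])
  qed
  have cl_scale: "in_cl (c *\<^sub>C a)" if a: "in_cl a" for c a
  proof -
    obtain xs where "(\<lambda>n. P (xs n)) \<longlonglongrightarrow> a"
      using a unfolding in_cl_def by (rule exE)
    then have "(\<lambda>n. P (c *\<^sub>C xs n)) \<longlonglongrightarrow> c *\<^sub>C a"
      by (simp add: cblinfun_scaleC_right bounded_linear.tendsto[OF bounded_linear_scaleC_right])
    then show ?thesis unfolding in_cl_def by (rule exI[of _ "\<lambda>n. c *\<^sub>C xs n"])
  qed
  have uniq: "a = b" if a: "in_cl a" and b: "in_cl b" and eq: "\<And>x. cinner a (P x) = cinner b (P x)"
    for a b
  proof -
    have "in_cl (a + (-1) *\<^sub>C b)"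
      by (intro cl_add cl_scale a b)
    moreover have m1: "(-1) *\<^sub>C b = - b"
      using complex_vector.scale_minus_left[of 1 b] by (simp add: scaleC_one)
    ultimately obtain xs where xs: "(\<lambda>n. P (xs n)) \<longlonglongrightarrow> a - b"
      unfolding in_cl_def by (auto elim: exE)
    have "(\<lambda>n. cinner (a - b) (P (xs n))) \<longlonglongrightarrow> cinner (a - b) (a - b)"
      by (intro tendsto_intros xs)
    then have "cinner (a - b) (a - b) = 0"
      by (simp add: cinner_diff_left eq LIMSEQ_const_iff)
    then show ?thesis
      by (simp add: cinner_self)
  qed
  have "\<exists>z. in_cl z \<and> (\<forall>x. cinner y (A x) = cinner z (P x)) \<and> norm z \<le> K * norm y" for y
  proof -
    have "cmod (cinner y (A x)) \<le> (K * norm y) * norm (P x)" for x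
      using cinner_cauchy_schwarz[of y "A x"] mult_left_mono[OF bound[of x] norm_ge_zero[of y]]
      by (simp add: mult_ac)
    then show ?thesis
      using riesz_range[of "\<lambda>x. cinner y (A x)" "K * norm y" P] K
      unfolding in_cl_def
      by (auto simp: cblinfun_add_right cblinfun_scaleC_right cinner_add_right cinner_scaleC_right)
  qed
  then obtain w where w: "\<And>y. in_cl (w y)" "\<And>x y. cinner y (A x) = cinner (w y) (P x)"
      "\<And>y. norm (w y) \<le> K * norm y"
    by metis
  have "cblinfun_apply (CBlinfun w) y = w y" for y
  proof (rule CBlinfun_apply)
    show "w (x + y) = w x + w y" for x y
      by (rule uniq) (auto intro!: cl_add w(1) simp: w(2)[symmetric] cinner_add_left)
    show "w (c *\<^sub>C x) = c *\<^sub>C w x" for c x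
      by (rule uniq) (auto intro!: cl_scale w(1) simp: w(2)[symmetric] cinner_scaleC_left)
  qed (rule w(3))
  then show ?thesis
    using w(2) by (intro exI[of _ "CBlinfun w"]) simp
qed

text \<open>Existence comes from factoring \<open>A\<close> through the identity, uniqueness from
  \<open>cinner_ext\<close>; together they resolve the description in \<open>adj\<close>.\<close>

lemma cinner_adj:
  fixes A :: "'a::chilbert_space \<Rightarrow>\<^sub>C\<^sub>L 'b::chilbert_space"
  shows "cinner (A x) y = cinner x (adj A y)"
proof -
  obtain W :: "'b \<Rightarrow>\<^sub>C\<^sub>L 'a" where "\<And>x y. cinner y (A x) = cinner (W y) x"
    using douglas[of A "norm A" "id_cblinfun :: 'a \<Rightarrow>\<^sub>C\<^sub>L 'a"] norm_cblinfun_bound[of A] by auto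
  then have W: "\<forall>x y. cinner (A x) y = cinner x (W y)"
    by (metis cinner_commute)
  have "adj A = W"
    unfolding adj_def
  proof (rule the_equality)
    fix B :: "'b \<Rightarrow>\<^sub>C\<^sub>L 'a" assume "\<forall>x y. cinner (A x) y = cinner x (B y)"
    then show "B = W"
      using W by (intro cblinfun_eqI cinner_ext) metis
  qed (rule W)
  then show ?thesis using W by simp
qed

lemma cinner_adj': "cinner (adj A x) y = cinner x (cblinfun_apply A y)"
  by (metis cinner_adj cinner_commute)

section \<open>Square roots of positive operators\<close>

lemma norm_positive_contraction:
  fixes Q :: "'a::chilbert_space \<Rightarrow>\<^sub>C\<^sub>L 'a"
  assumes sa: "\<And>x y. cinner (Q x) y = cinner x (Q y)"
    and pos: "\<And>x. Re (cinner x (Q x)) \<ge> 0" and le: "\<And>x. Re (cinner x (Q x)) \<le> (norm x)\<^sup>2"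
  shows "norm Q \<le> 1"
proof (rule norm_cblinfun_le)
  have polar: "4 * Re (cinner y (Q x)) \<le> (norm (x + y))\<^sup>2" for x y
  proof -
    have "Re (cinner x (Q y)) = Re (cinner y (Q x))"
      using sa[of x y] by (metis Re_cinner inner_commute)
    then have "4 * Re (cinner y (Q x)) =
        Re (cinner (x + y) (Q (x + y))) - Re (cinner (x - y) (Q (x - y)))"
      by (simp add: cblinfun_add_right cblinfun_diff_right cinner_add_left cinner_add_right
          cinner_diff_left cinner_diff_right)
    then show ?thesis
      using le[of "x + y"] pos[of "x - y"] by simp
  qed
  fix x
  show "norm (Q x) \<le> 1 * norm x"
  proof (cases "x = 0 \<or> Q x = 0")
    case False
    \<comment> \<open>\<open>Q x\<close> rescaled to the length of \<open>x\<close>: this maximizes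
      the inner product with \<open>Q x\<close> at that length and keeps
      \<open>norm (x + ?y)\<close> at most \<open>2 * norm x\<close>, so the factor 4 in
      \<open>polar\<close> cancels.\<close>
    let ?y = "(norm x / norm (Q x)) *\<^sub>R Q x"
    have "norm (x + ?y) \<le> 2 * norm x"
      using norm_triangle_ineq[of x ?y] False by simp
    then have "(norm (x + ?y))\<^sup>2 \<le> (2 * norm x)\<^sup>2"
      by (intro power_mono) auto
    moreover have "Re (cinner ?y (Q x)) = norm x * norm (Q x)"
      using False by (simp add: cinner_scaleR_left cinner_self power2_eq_square)
    ultimately have "norm x * norm (Q x) \<le> norm x * norm x"
      using polar[of ?y x] by (simp add: power2_eq_square)
    then show ?thesis using False by simp
  qed auto
qed simp

text \<open>The sesquilinear defect \<open>d\<close> vanishes on the diagonal, hence is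
  antisymmetric. Replacing \<open>y\<close> by \<open>\<i> *\<^sub>C y\<close> shows that it is
  symmetric too, so it is zero; the complex scalars are essential here.\<close>

lemma positive_op_selfadjoint:
  assumes "positive_op P"
  shows "cinner (cblinfun_apply P x) y = cinner x (P y)"
proof -
  define d where "d u v = cinner (P u) v - cinner u (P v)" for u v
  have d_self: "d u u = 0" for u
  proof -
    have "cinner u (P u) \<in> \<real>"
      using assms nonneg_Reals_subset_Reals unfolding positive_op_def by blast
    then show ?thesis
      unfolding d_def by (metis Reals_cnj_iff cinner_commute right_minus_eq)
  qed
  have add: "d (u + v) (u + v) = d u u + d u v + d v u + d v v" for u v
    unfolding d_def by (simp add: cblinfun_add_right cinner_add_left cinner_add_right)
  have 1: "d u v + d v u = 0" for u v
    using add[of u v] d_self by simp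
  have "d x (\<i> *\<^sub>C y) = \<i> * d x y" "d (\<i> *\<^sub>C y) x = - \<i> * d y x"
    unfolding d_def
    by (simp_all add: cblinfun_scaleC_right cinner_scaleC_left cinner_scaleC_right algebra_simps)
  then have "d x y - d y x = 0"
    using 1[of x "\<i> *\<^sub>C y"] by (simp add: right_diff_distrib[symmetric])
  then have "d x y = 0"
    using 1[of x y] by simp
  then show ?thesis by (simp add: d_def)
qed

text \<open>After scaling, \<open>P / c = 1 - Q\<close> with \<open>0 \<le> Q \<le> 1\<close>.
  Looking for a root of the form \<open>1 - L\<close> turns \<open>(1 - L)\<^sup>2 = 1 - Q\<close>
  into the fixed point equation \<open>L = (Q + L\<^sup>2) / 2\<close>, which is solved by iteration
  from 0.\<close>

lemma positive_op_sqrt: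
  fixes P :: "'a::chilbert_space \<Rightarrow>\<^sub>C\<^sub>L 'a"
  assumes pos: "positive_op P"
  shows "\<exists>S :: 'a \<Rightarrow>\<^sub>C\<^sub>L 'a. (\<forall>x y. cinner (cblinfun_apply S x) y = cinner x (cblinfun_apply S y)) \<and> S o\<^sub>C S = P"
proof -
  \<comment> \<open>The summand 1 keeps \<open>c\<close> positive when \<open>P = 0\<close>.\<close>
  define c where "c = norm P + 1"
  have c: "c > 0" unfolding c_def by (simp add: add_nonneg_pos)
  define Q where "Q = id_cblinfun - (1 / c) *\<^sub>R P"
  have Re_P: "0 \<le> Re (cinner x (P x))" "Re (cinner x (P x)) \<le> c * (norm x)\<^sup>2" for x
  proof -
    show "0 \<le> Re (cinner x (P x))"
      using pos unfolding positive_op_def by (simp add: complex_nonneg_Reals_iff)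
    have "Re (cinner x (P x)) \<le> norm x * norm (P x)"
      using cinner_cauchy_schwarz[of x "P x"] complex_Re_le_cmod order_trans by blast
    also have "\<dots> \<le> norm x * (norm P * norm x)"
      by (intro mult_left_mono norm_cblinfun_bound norm_ge_zero)
    also have "\<dots> \<le> c * (norm x)\<^sup>2"
      unfolding c_def by (simp add: power2_eq_square algebra_simps)
    finally show "Re (cinner x (P x)) \<le> c * (norm x)\<^sup>2" .
  qed
  have Q_sa: "cinner (Q x) y = cinner x (Q y)" for x y
    unfolding Q_def
    by (simp add: cinner_diff_left cinner_diff_right cinner_scaleR_left cinner_scaleR_right
        positive_op_selfadjoint[OF pos])
  have Re_Q: "Re (cinner x (Q x)) = (norm x)\<^sup>2 - Re (cinner x (P x)) / c" for x
    unfolding Q_def by (simp add: cinner_diff_right cinner_scaleR_right cinner_self)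
  have Re_P': "0 \<le> Re (cinner x (P x)) / c" "Re (cinner x (P x)) / c \<le> (norm x)\<^sup>2" for x
    using Re_P[of x] c by (simp_all add: divide_le_eq mult.commute)
  have normQ: "norm Q \<le> 1"
    by (rule norm_positive_contraction[OF Q_sa]) (unfold Re_Q, use Re_P' in simp_all)
  define Y where "Y = rec_nat 0 (\<lambda>_ Z. (1/2) *\<^sub>R (Q + Z o\<^sub>C Z))"
  \<comment> \<open>Scalar majorant: the same recursion with \<open>Q\<close> replaced by its norm
    bound 1. When \<open>norm Q = 1\<close> a uniform contraction estimate may fail, so the
    increments of \<open>Y\<close> are dominated by those of \<open>y\<close>; these telescope, and
    \<open>y\<close> is increasing and bounded by 1.\<close>
  define y :: "nat \<Rightarrow> real" where "y = rec_nat 0 (\<lambda>_ z. (1 + z\<^sup>2) / 2)"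
  have Y_Suc: "Y (Suc n) = (1/2) *\<^sub>R (Q + Y n o\<^sub>C Y n)" and Y_0: "Y 0 = 0" for n
    unfolding Y_def by simp_all
  have y_Suc: "y (Suc n) = (1 + (y n)\<^sup>2) / 2" and y_0: "y 0 = 0" for n
    unfolding y_def by simp_all
  have y_01: "0 \<le> y n \<and> y n \<le> 1" for n
  proof (induction n)
    case (Suc n)
    then have "(y n)\<^sup>2 \<le> 1" by (simp add: power_le_one)
    then show ?case by (simp add: y_Suc)
  qed (simp add: y_0)
  have y_mono: "y n \<le> y (Suc n)" for n
    using zero_le_power2[of "1 - y n"] by (simp add: y_Suc power2_eq_square algebra_simps)
  have norm_Y: "norm (Y n) \<le> y n" for n
  proof (induction n)
    case (Suc n)
    have "norm (Y n o\<^sub>C Y n) \<le> norm (Y n) * norm (Y n)"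
      by (rule norm_cblinfun_compose_le)
    also have "\<dots> \<le> (y n)\<^sup>2"
      unfolding power2_eq_square by (intro mult_mono Suc.IH) (use y_01 in auto)
    finally have "norm (Q + Y n o\<^sub>C Y n) \<le> 1 + (y n)\<^sup>2"
      using norm_triangle_ineq[of Q "Y n o\<^sub>C Y n"] normQ by linarith
    then show ?case by (simp add: Y_Suc y_Suc)
  qed (simp add: Y_0 y_0)
  have step: "norm (Y (Suc n) - Y n) \<le> y (Suc n) - y n" for n
  proof (induction n)
    case 0
    then show ?case using norm_Y[of "Suc 0"] by (simp add: Y_0 y_0)
  next
    case (Suc n)
    let ?D = "Y (Suc n) - Y n"
    \<comment> \<open>This form of the difference of squares needs no commutation of the iterates.\<close>
    have "Y (Suc (Suc n)) - Y (Suc n) = (1/2) *\<^sub>R (Y (Suc n) o\<^sub>C ?D + ?D o\<^sub>C Y n)"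
      unfolding Y_Suc[of "Suc n"] Y_Suc[of n, symmetric]
      by (subst (3) Y_Suc)
        (rule cblinfun_eqI, simp add: cblinfun_diff_right scaleR_diff_right scaleR_add_right)
    then have "norm (Y (Suc (Suc n)) - Y (Suc n)) \<le> (norm (Y (Suc n) o\<^sub>C ?D) + norm (?D o\<^sub>C Y n)) / 2"
      using norm_triangle_ineq[of "Y (Suc n) o\<^sub>C ?D" "?D o\<^sub>C Y n"] by simp
    also have "\<dots> \<le> (norm (Y (Suc n)) * norm ?D + norm ?D * norm (Y n)) / 2"
      by (intro divide_right_mono add_mono norm_cblinfun_compose_le) simp
    also have "\<dots> \<le> (y (Suc n) * (y (Suc n) - y n) + (y (Suc n) - y n) * y n) / 2"
      by (intro divide_right_mono add_mono mult_mono norm_Y Suc.IH)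
        (use y_01 y_mono[of n] in auto)
    also have "\<dots> = y (Suc (Suc n)) - y (Suc n)"
    proof -
      have "y (Suc (Suc n)) - y (Suc n) = ((y (Suc n))\<^sup>2 - (y n)\<^sup>2) / 2"
        using y_Suc[of "Suc n"] y_Suc[of n] by (simp add: diff_divide_distrib add_divide_distrib)
      moreover have "y (Suc n) * (y (Suc n) - y n) + (y (Suc n) - y n) * y n = (y (Suc n))\<^sup>2 - (y n)\<^sup>2"
        by (simp add: power2_eq_square algebra_simps)
      ultimately show ?thesis by simp
    qed
    finally show ?case .
  qed
  have gap: "norm (Y (n + k) - Y n) \<le> y (n + k) - y n" for n k
  proof (induction k)
    case (Suc k)
    then show ?case
      using step[of "n + k"] norm_triangle_ineq[of "Y (Suc (n + k)) - Y (n + k)" "Y (n + k) - Y n"]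
      by simp
  qed simp
  have "convergent y"
    using incseq_convergent[of y 1] incseq_SucI[of y] y_mono y_01 unfolding convergent_def by metis
  then have "Cauchy y" by (rule convergent_Cauchy)
  have "Cauchy Y"
  proof (rule CauchyI)
    fix e :: real assume "e > 0"
    then obtain M where M: "\<And>m n. m \<ge> M \<Longrightarrow> n \<ge> M \<Longrightarrow> \<bar>y m - y n\<bar> < e"
      using \<open>Cauchy y\<close> unfolding Cauchy_iff by force
    have "norm (Y m - Y n) < e" if "m \<ge> M" "n \<ge> m" for m n
      using gap[of m "n - m"] M[of n m] that by (simp add: norm_minus_commute)
    then have "norm (Y m - Y n) < e" if "m \<ge> M" "n \<ge> M" for m n
      using that by (metis nle_le norm_minus_commute)
    then show "\<exists>M. \<forall>m\<ge>M. \<forall>n\<ge>M. norm (Y m - Y n) < e" by blast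
  qed
  then obtain L where L: "Y \<longlonglongrightarrow> L"
    by (auto simp: Cauchy_convergent_iff convergent_def)
  have "(\<lambda>n. Y (Suc n)) \<longlonglongrightarrow> (1/2) *\<^sub>R (Q + L o\<^sub>C L)"
    unfolding Y_Suc
    by (intro tendsto_intros bounded_bilinear.tendsto[OF bounded_bilinear_cblinfun_compose] L)
  then have L_eq: "L = (1/2) *\<^sub>R (Q + L o\<^sub>C L)"
    using LIMSEQ_Suc[OF L] LIMSEQ_unique by blast
  have LL: "L (L x) = 2 *\<^sub>R L x - Q x" for x
  proof -
    have "2 *\<^sub>R L x = Q x + L (L x)"
      using arg_cong[OF L_eq, of "\<lambda>A. 2 *\<^sub>R cblinfun_apply A x"] by simp
    then show ?thesis by simp
  qed
  have Y_sa: "cinner (Y n u) v = cinner u (Y n v)" for n u v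
    by (induction n arbitrary: u v)
      (simp_all add: Y_0 Y_Suc cinner_scaleR_left cinner_scaleR_right cinner_add_left
        cinner_add_right Q_sa)
  have L_sa: "cinner (L u) v = cinner u (L v)" for u v
  proof -
    note lim = bounded_linear.tendsto[OF bounded_linear_cblinfun_apply_left L]
    have "(\<lambda>n. cinner (Y n u) v) \<longlonglongrightarrow> cinner (L u) v" "(\<lambda>n. cinner u (Y n v)) \<longlonglongrightarrow> cinner u (L v)"
      by (intro tendsto_intros lim)+
    then show ?thesis
      unfolding Y_sa using LIMSEQ_unique by blast
  qed
  define S where "S = sqrt c *\<^sub>R (id_cblinfun - L)"
  have "S o\<^sub>C S = P"
  proof (rule cblinfun_eqI)
    fix x
    have "(S o\<^sub>C S) x = c *\<^sub>R (x - L x - (L x - L (L x)))"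
      unfolding S_def
      using c linear_scale[OF bounded_linear.linear[OF bounded_linear_cblinfun[of L]]]
      by (simp add: cblinfun_diff_right scaleR_diff_right)
    also have "\<dots> = c *\<^sub>R (x - Q x)"
      by (simp add: LL scaleR_2)
    also have "\<dots> = P x"
      using c by (simp add: Q_def)
    finally show "(S o\<^sub>C S) x = P x" .
  qed
  moreover have "cinner (S u) v = cinner u (S v)" for u v
    unfolding S_def
    by (simp add: cinner_scaleR_left cinner_scaleR_right cinner_diff_left cinner_diff_right L_sa)
  ultimately show ?thesis by blast
qed

section \<open>Orthonormal bases\<close>

lemma onb_cinner: "is_onb B \<Longrightarrow> x \<in> B \<Longrightarrow> y \<in> B \<Longrightarrow> cinner x y = (if x = y then 1 else 0)"
  unfolding is_onb_def by blast

text \<open>Completing the square in the coefficients. The Fourier coefficients for \<open>a\<close>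
  give Bessel's inequality; for any other \<open>a\<close> the last sum is the excess over the best
  approximation.\<close>

lemma norm_diff_orthonormal_combination:
  fixes x :: "'a::complex_inner"
  assumes F: "finite F" and on: "\<And>e e'. e \<in> F \<Longrightarrow> e' \<in> F \<Longrightarrow> cinner e e' = (if e = e' then 1 else 0)"
  shows "(norm (x - (\<Sum>e\<in>F. a e *\<^sub>C e)))\<^sup>2 =
    (norm x)\<^sup>2 - (\<Sum>e\<in>F. (cmod (cinner e x))\<^sup>2) + (\<Sum>e\<in>F. (cmod (cinner e x - a e))\<^sup>2)"
proof -
  let ?s = "\<Sum>e\<in>F. a e *\<^sub>C e"
  have es: "cinner e ?s = a e" if "e \<in> F" for e
  proof -
    have "cinner e ?s = (\<Sum>e'\<in>F. a e' * (if e = e' then 1 else 0))"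
      unfolding cinner_sum_right by (intro sum.cong) (simp_all add: cinner_scaleC_right on that)
    also have "\<dots> = a e"
      using that F by (simp add: sum.delta' if_distrib cong: if_cong)
    finally show ?thesis .
  qed
  have ss: "cinner ?s ?s = (\<Sum>e\<in>F. cnj (a e) * a e)"
    by (subst cinner_sum_left, intro sum.cong) (simp_all add: cinner_scaleC_left es)
  have sx: "cinner ?s x = (\<Sum>e\<in>F. cnj (a e) * cinner e x)"
    by (simp add: cinner_sum_left cinner_scaleC_left)
  have xs: "cinner x ?s = (\<Sum>e\<in>F. a e * cnj (cinner e x))"
    unfolding cinner_sum_right cinner_scaleC_right by (metis cinner_commute)
  have "complex_of_real ((norm (x - ?s))\<^sup>2) =
      cinner x x - cinner x ?s - cinner ?s x + cinner ?s ?s"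
    unfolding cinner_self[symmetric] by (simp add: cinner_diff_left cinner_diff_right)
  also have "\<dots> = cinner x x - (\<Sum>e\<in>F. cinner e x * cnj (cinner e x))
      + (\<Sum>e\<in>F. (cinner e x - a e) * cnj (cinner e x - a e))"
    unfolding ss sx xs
    by (simp add: sum_subtractf[symmetric] sum.distrib[symmetric] algebra_simps)
  also have "\<dots> = complex_of_real
      ((norm x)\<^sup>2 - (\<Sum>e\<in>F. (cmod (cinner e x))\<^sup>2) + (\<Sum>e\<in>F. (cmod (cinner e x - a e))\<^sup>2))"
    unfolding complex_norm_square[symmetric] cinner_self
    by (simp add: complex_norm_square[symmetric])
  finally show ?thesis
    using of_real_eq_iff by blast
qed

text \<open>Density provides a finite combination within \<open>sqrt \<epsilon>\<close> of
  \<open>x\<close>. Its support already accounts for all but \<open>\<epsilon>\<close> of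
  \<open>(norm x)\<^sup>2\<close>, and Bessel's inequality keeps every larger finite partial sum
  below \<open>(norm x)\<^sup>2\<close>.\<close>

lemma parseval:
  assumes onb: "is_onb B"
  shows "((\<lambda>e. (cmod (cinner e x))\<^sup>2) has_sum (norm x)\<^sup>2) B"
  unfolding has_sum_def
proof (rule tendstoI)
  let ?f = "\<lambda>e. (cmod (cinner e x))\<^sup>2"
  fix \<epsilon> :: real assume \<epsilon>: "\<epsilon> > 0"
  have on: "cinner e e' = (if e = e' then 1 else 0)" if "e \<in> B" "e' \<in> B" for e e'
    using onb that by (rule onb_cinner)
  have bessel: "sum ?f Y \<le> (norm x)\<^sup>2" if "finite Y" "Y \<subseteq> B" for Y
  proof -
    have "cinner e e' = (if e = e' then 1 else 0)" if "e \<in> Y" "e' \<in> Y" for e e'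
      using on that \<open>Y \<subseteq> B\<close> by blast
    from norm_diff_orthonormal_combination[OF \<open>finite Y\<close> this, of x "\<lambda>e. cinner e x"]
    have "(norm (x - (\<Sum>e\<in>Y. cinner e x *\<^sub>C e)))\<^sup>2 = (norm x)\<^sup>2 - sum ?f Y"
      by simp
    moreover have "0 \<le> (norm (x - (\<Sum>e\<in>Y. cinner e x *\<^sub>C e)))\<^sup>2" by simp
    ultimately show ?thesis by linarith
  qed
  have "x \<in> closure (cspan B)"
    using onb unfolding is_onb_def by simp
  then obtain y where y: "y \<in> cspan B" "dist y x < sqrt \<epsilon>"
    using \<epsilon> by (meson closure_approachable real_sqrt_gt_zero)
  then obtain F a where F: "finite F" "F \<subseteq> B" and y_eq: "y = (\<Sum>e\<in>F. a e *\<^sub>C e)"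
    unfolding complex_vector.span_explicit by blast
  have "(norm (x - y))\<^sup>2 < \<epsilon>"
    using y(2) \<epsilon> by (metis dist_commute dist_norm norm_ge_zero real_less_rsqrt sqrt_le_D
        real_sqrt_less_iff real_sqrt_abs abs_norm_cancel)
  moreover have "(norm (x - y))\<^sup>2 \<ge> (norm x)\<^sup>2 - sum ?f F"
  proof -
    have "cinner e e' = (if e = e' then 1 else 0)" if "e \<in> F" "e' \<in> F" for e e'
      using on that \<open>F \<subseteq> B\<close> by blast
    from norm_diff_orthonormal_combination[OF \<open>finite F\<close> this, of x a]
    show ?thesis
      unfolding y_eq by (simp add: sum_nonneg)
  qed
  ultimately have F': "(norm x)\<^sup>2 - sum ?f F < \<epsilon>" by linarith
  have "dist (sum ?f Y) ((norm x)\<^sup>2) < \<epsilon>" if "finite Y" "F \<subseteq> Y" "Y \<subseteq> B" for Y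
  proof -
    have "sum ?f F \<le> sum ?f Y"
      using that by (intro sum_mono2) auto
    then show ?thesis
      using bessel[of Y] that F' by (simp add: dist_real_def)
  qed
  then show "\<forall>\<^sub>F Y in finite_subsets_at_top B. dist (sum ?f Y) ((norm x)\<^sup>2) < \<epsilon>"
    unfolding eventually_finite_subsets_at_top using F by blast
qed

lemma finite_onb_expansion:
  assumes "is_onb B" "finite B"
  shows "(\<Sum>e\<in>B. cinner e x *\<^sub>C e) = x"
proof -
  have "(\<Sum>e\<in>B. (cmod (cinner e x))\<^sup>2) = (norm x)\<^sup>2"
    using parseval[OF assms(1), of x] assms(2) by (simp add: has_sum_finite_iff)
  then have "(norm (x - (\<Sum>e\<in>B. cinner e x *\<^sub>C e)))\<^sup>2 = 0"
    using norm_diff_orthonormal_combination[OF assms(2) onb_cinner[OF assms(1)], of x "\<lambda>e. cinner e x"]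
    by simp
  then show ?thesis by simp
qed

text \<open>Finite dimension is given by a spanning set, whereas the trace formulas need an
  orthonormal one. A vector with zero residual adds nothing and is dropped.\<close>

lemma gram_schmidt:
  assumes "finite (B::'a::complex_inner set)"
  shows "\<exists>C. finite C \<and> (\<forall>x\<in>C. \<forall>y\<in>C. cinner x y = (if x = y then 1 else 0)) \<and> cspan C = cspan B"
  using assms
proof (induction B)
  case empty
  then show ?case by (intro exI[of _ "{}"]) simp
next
  case (insert b B)
  then obtain C where C: "finite C" "\<And>x y. x \<in> C \<Longrightarrow> y \<in> C \<Longrightarrow> cinner x y = (if x = y then 1 else 0)"
    and span: "cspan C = cspan B" by blast
  define p where "p = (\<Sum>e\<in>C. cinner e b *\<^sub>C e)"
  define r where "r = b - p"
  have p: "p \<in> cspan C"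
    unfolding p_def
    by (intro complex_vector.span_sum complex_vector.span_scale complex_vector.span_base)
  have orth: "cinner e r = 0" if "e \<in> C" for e
  proof -
    have "cinner e p = (\<Sum>e'\<in>C. cinner e' b * (if e = e' then 1 else 0))"
      unfolding p_def cinner_sum_right
      by (intro sum.cong) (simp_all add: cinner_scaleC_right C that)
    also have "\<dots> = cinner e b"
      using that C(1) by (simp add: if_distrib cong: if_cong)
    finally show ?thesis by (simp add: r_def cinner_diff_right)
  qed
  have span_insert: "cspan (insert b B) = cspan (insert r C)"
  proof -
    have "cspan (insert b B) = cspan (insert b C)"
      using span by (simp add: complex_vector.span_insert)
    also have "\<dots> = cspan (insert r C)"
      unfolding r_def using p complex_vector.eq_span_insert_eq[of b "b - p" C] by simp
    finally show ?thesis .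
  qed
  show ?case
  proof (cases "r = 0")
    case True
    then show ?thesis
      using C span_insert by (intro exI[of _ C]) auto
  next
    case False
    define u where "u = complex_of_real (inverse (norm r)) *\<^sub>C r"
    have u1: "cinner u u = 1"
      using False by (simp add: u_def cinner_self norm_scaleC norm_inverse)
    have u0: "cinner e u = 0" "cinner u e = 0" if "e \<in> C" for e
    proof -
      show "cinner e u = 0" using orth[OF that] by (simp add: u_def cinner_scaleC_right)
      then show "cinner u e = 0" by (metis cinner_commute complex_cnj_zero)
    qed
    have "u \<in> cspan (insert r C)"
      unfolding u_def by (intro complex_vector.span_scale complex_vector.span_base) simp
    moreover have "r \<in> cspan (insert u C)"
    proof -
      have "complex_of_real (norm r) *\<^sub>C u = r"
        using False by (simp add: u_def scaleC_scaleC scaleC_one flip: of_real_mult)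
      then show ?thesis
        by (metis complex_vector.span_scale complex_vector.span_base insertI1)
    qed
    ultimately have "cspan (insert u C) = cspan (insert r C)"
      by (intro complex_vector.span_eq[THEN iffD2])
        (auto intro: complex_vector.span_base)
    moreover have "u \<notin> C"
      using u0(1)[of u] u1 by auto
    ultimately show ?thesis
      using C u0 u1 span_insert by (intro exI[of _ "insert u C"]) (auto simp: C)
  qed
qed

section \<open>Hilbert-Schmidt operators and traces\<close>

text \<open>One basis is enough, as \<open>hilbert_schmidt_has_sum\<close> shows for codomains that
  have a basis. The witness also serves as a source of bases.\<close>

definition hilbert_schmidt :: "('a::chilbert_space \<Rightarrow>\<^sub>C\<^sub>L 'b::chilbert_space) \<Rightarrow> bool"
  where "hilbert_schmidt C \<longleftrightarrow> (\<exists>B. is_onb B \<and> (\<lambda>e. (norm (C e))\<^sup>2) summable_on B)"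

text \<open>The condition inside the description \<open>tr\<close>. As a relation it can be added
  and scaled before \<open>tr\<close> is known to be meaningful.\<close>

definition has_trace :: "('a::chilbert_space \<Rightarrow>\<^sub>C\<^sub>L 'a) \<Rightarrow> complex \<Rightarrow> bool"
  where "has_trace A z \<longleftrightarrow> (\<forall>B. is_onb B \<longrightarrow> ((\<lambda>e. cinner e (A e)) has_sum z) B)"

text \<open>Both sides are the double sum of \<open>(cmod (cinner f (C e)))\<^sup>2\<close> over
  \<open>E \<times> F\<close>. Its terms are nonnegative, so the order of summation can be
  exchanged, and Parseval evaluates the inner sum in either order.\<close>

lemma has_sum_norm_square_adj:
  fixes C :: "'a::chilbert_space \<Rightarrow>\<^sub>C\<^sub>L 'b::chilbert_space"
  assumes E: "is_onb E" and F: "is_onb F" and sum: "((\<lambda>e. (norm (C e))\<^sup>2) has_sum z) E"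
  shows "((\<lambda>f. (norm (adj C f))\<^sup>2) has_sum z) F"
proof -
  let ?g = "\<lambda>(e, f). (cmod (cinner f (C e)))\<^sup>2"
  have inner: "((\<lambda>f. ?g (e, f)) has_sum (norm (C e))\<^sup>2) F" for e
    using parseval[OF F, of "C e"] by simp
  have "?g summable_on E \<times> F"
    by (rule summable_on_SigmaI[OF inner]) (use sum in \<open>auto simp: summable_on_def\<close>)
  then have "(?g has_sum z) (E \<times> F)"
    using has_sum_SigmaI[OF inner sum] by simp
  then have swapped: "((\<lambda>(f, e). ?g (e, f)) has_sum z) (F \<times> E)"
    by (subst (asm) has_sum_swap) simp
  have "((\<lambda>e. (cmod (cinner f (C e)))\<^sup>2) has_sum (norm (adj C f))\<^sup>2) E" for f
  proof -
    have "cmod (cinner f (C e)) = cmod (cinner e (adj C f))" for e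
      by (metis cinner_adj cinner_commute complex_mod_cnj)
    then show ?thesis
      using parseval[OF E, of "adj C f"] by simp
  qed
  then show ?thesis
    by (intro has_sum_SigmaD[OF swapped]) simp
qed

lemma adj_adj [simp]: "adj (adj A) = A"
  by (intro cblinfun_eqI cinner_ext) (metis cinner_adj cinner_adj')

lemma adj_compose: "adj (A o\<^sub>C B) = adj B o\<^sub>C adj A"
  by (intro cblinfun_eqI cinner_ext) (simp add: cinner_adj[symmetric])

text \<open>Taking the adjoint twice moves the sum from \<open>E\<close> to the intermediate basis
  \<open>F\<close> of the codomain and back to an arbitrary basis \<open>B\<close> of the
  domain.\<close>

lemma hilbert_schmidt_has_sum:
  fixes C :: "'a::chilbert_space \<Rightarrow>\<^sub>C\<^sub>L 'b::chilbert_space"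
  assumes C: "hilbert_schmidt C" and F: "is_onb (F :: 'b set)"
  shows "\<exists>z. \<forall>B. is_onb B \<longrightarrow> ((\<lambda>e. (norm (C e))\<^sup>2) has_sum z) B"
proof -
  obtain E z where E: "is_onb E" and z: "((\<lambda>e. (norm (C e))\<^sup>2) has_sum z) E"
    using C unfolding hilbert_schmidt_def summable_on_def by blast
  have "((\<lambda>e. (norm (C e))\<^sup>2) has_sum z) B" if "is_onb B" for B
    using has_sum_norm_square_adj[OF F that has_sum_norm_square_adj[OF E F z]] by simp
  then show ?thesis by blast
qed

lemma hilbert_schmidt_adj:
  fixes C :: "'a::chilbert_space \<Rightarrow>\<^sub>C\<^sub>L 'b::chilbert_space"
  assumes "hilbert_schmidt C" and "is_onb (F :: 'b set)"
  shows "hilbert_schmidt (adj C)"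
  using assms has_sum_norm_square_adj[OF _ assms(2), of _ C]
  unfolding hilbert_schmidt_def summable_on_def by meson

lemma hilbert_schmidt_compose_left:
  assumes "hilbert_schmidt C"
  shows "hilbert_schmidt (G o\<^sub>C C)"
proof -
  obtain B where B: "is_onb B" "(\<lambda>e. (norm (C e))\<^sup>2) summable_on B"
    using assms unfolding hilbert_schmidt_def by blast
  have "(norm (G (C e)))\<^sup>2 \<le> (norm G)\<^sup>2 * (norm (C e))\<^sup>2" for e
    using norm_cblinfun_bound[of G "C e"]
    by (metis norm_ge_zero power_mono power_mult_distrib)
  then have "(\<lambda>e. (norm ((G o\<^sub>C C) e))\<^sup>2) summable_on B"
    by (intro summable_on_comparison_test[OF summable_on_cmult_right[OF B(2), of "(norm G)\<^sup>2"]]) simp_all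
  then show ?thesis
    using B(1) unfolding hilbert_schmidt_def by blast
qed

text \<open>The adjoint reverses composition, so this is the left-hand version for
  \<open>adj C\<close>.\<close>

lemma hilbert_schmidt_compose_right:
  fixes C :: "'a::chilbert_space \<Rightarrow>\<^sub>C\<^sub>L 'b::chilbert_space" and G :: "'c::chilbert_space \<Rightarrow>\<^sub>C\<^sub>L 'a"
  assumes C: "hilbert_schmidt C" and F: "is_onb (F :: 'b set)" and H: "is_onb (H :: 'c set)"
  shows "hilbert_schmidt (C o\<^sub>C G)"
  using hilbert_schmidt_adj[OF hilbert_schmidt_compose_left[OF hilbert_schmidt_adj[OF C F], of "adj G"] H]
  by (simp add: adj_compose)

lemma hilbert_schmidt_scaleC: "hilbert_schmidt C \<Longrightarrow> hilbert_schmidt (c *\<^sub>C C)"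
  unfolding hilbert_schmidt_def
  by (auto simp: norm_scaleC power_mult_distrib intro!: summable_on_cmult_right)

lemma hilbert_schmidt_add:
  fixes C D :: "'a::chilbert_space \<Rightarrow>\<^sub>C\<^sub>L 'b::chilbert_space"
  assumes C: "hilbert_schmidt C" and D: "hilbert_schmidt D" and F: "is_onb (F :: 'b set)"
  shows "hilbert_schmidt (C + D)"
proof -
  obtain B where B: "is_onb B" "(\<lambda>e. (norm (C e))\<^sup>2) summable_on B"
    using C unfolding hilbert_schmidt_def by blast
  have "(\<lambda>e. (norm (D e))\<^sup>2) summable_on B"
    using hilbert_schmidt_has_sum[OF D F] B(1) unfolding summable_on_def by blast
  then have s: "(\<lambda>e. 2 * ((norm (C e))\<^sup>2 + (norm (D e))\<^sup>2)) summable_on B"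
    by (intro summable_on_cmult_right summable_on_add B)
  have "(norm (C e + D e))\<^sup>2 \<le> 2 * ((norm (C e))\<^sup>2 + (norm (D e))\<^sup>2)" for e
  proof -
    have "(norm (C e + D e))\<^sup>2 \<le> (norm (C e) + norm (D e))\<^sup>2"
      by (intro power_mono norm_triangle_ineq) simp
    also have "\<dots> \<le> 2 * ((norm (C e))\<^sup>2 + (norm (D e))\<^sup>2)"
      using zero_le_power2[of "norm (C e) - norm (D e)"] by (simp add: power2_diff power2_sum)
    finally show ?thesis .
  qed
  then have "(\<lambda>e. (norm ((C + D) e))\<^sup>2) summable_on B"
    by (intro summable_on_comparison_test[OF s]) simp_all
  then show ?thesis
    using B(1) unfolding hilbert_schmidt_def by blast
qed

text \<open>The four terms have the common shape \<open>u + c *\<^sub>C v\<close> with explicit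
  scalar factors, so that a single family of sums indexed by \<open>c\<close> can be inserted term
  by term.\<close>

lemma cinner_polarization:
  "4 * cinner u (v::'a::complex_inner) = of_real ((norm (u + v))\<^sup>2) + (- 1) * of_real ((norm (u + (- 1) *\<^sub>C v))\<^sup>2)
    + (- \<i>) * of_real ((norm (u + \<i> *\<^sub>C v))\<^sup>2) + \<i> * of_real ((norm (u + (- \<i>) *\<^sub>C v))\<^sup>2)"
  unfolding cnorm_add_square cinner_scaleC_right norm_scaleC
  by (simp add: complex_eq_iff)

lemma hilbert_schmidt_compose_has_trace:
  fixes D :: "'a::chilbert_space \<Rightarrow>\<^sub>C\<^sub>L 'b::chilbert_space" and C :: "'b \<Rightarrow>\<^sub>C\<^sub>L 'a"
  assumes C: "hilbert_schmidt C" and D: "hilbert_schmidt D"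
  shows "\<exists>z. has_trace (C o\<^sub>C D) z"
proof -
  obtain E :: "'a set" where E: "is_onb E" using D unfolding hilbert_schmidt_def by blast
  obtain F :: "'b set" where F: "is_onb F" using C unfolding hilbert_schmidt_def by blast
  have C': "hilbert_schmidt (adj C)" using hilbert_schmidt_adj[OF C E] .
  \<comment> \<open>\<open>adj C\<close> and \<open>D\<close> have the same domain and codomain,
    hence can be added, and \<open>cinner e (C (D e)) = cinner (adj C e) (D e)\<close>. The
    intermediate space may differ from the outer one; partial traces use this.\<close>
  have "\<exists>z. \<forall>B. is_onb B \<longrightarrow> ((\<lambda>e. (norm (adj C e + c *\<^sub>C D e))\<^sup>2) has_sum z) B" for c
    using hilbert_schmidt_has_sum[OF hilbert_schmidt_add[OF C' hilbert_schmidt_scaleC[OF D, of c] F] F]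
    by simp
  then obtain q where q: "\<And>c B. is_onb B \<Longrightarrow> ((\<lambda>e. (norm (adj C e + c *\<^sub>C D e))\<^sup>2) has_sum q c) B"
    by metis
  have q': "((\<lambda>e. complex_of_real ((norm (adj C e + c *\<^sub>C D e))\<^sup>2)) has_sum of_real (q c)) B"
    if "is_onb B" for c B
    using has_sum_of_real[OF q[OF that]] by simp
  let ?w = "of_real (q 1) + (- 1) * of_real (q (- 1)) + (- \<i>) * of_real (q \<i>) + \<i> * of_real (q (- \<i>)) :: complex"
  have "((\<lambda>e. cinner e ((C o\<^sub>C D) e)) has_sum (1/4) * ?w) B" if B: "is_onb B" for B
  proof -
    have "((\<lambda>e. (1/4) * (4 * cinner (adj C e) (D e))) has_sum (1/4) * ?w) B"
      unfolding cinner_polarization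
      by (intro has_sum_cmult_right has_sum_add q' B q'[OF B, of 1, unfolded scaleC_one])
    then show ?thesis
      by (simp add: cinner_adj')
  qed
  then show ?thesis unfolding has_trace_def by blast
qed

section \<open>Factorization of trace-class operators and evaluation of traces\<close>

lemma trace_class_factorization:
  fixes A :: "'a::chilbert_space \<Rightarrow>\<^sub>C\<^sub>L 'a"
  assumes "trace_class A"
  shows "\<exists>C D :: 'a \<Rightarrow>\<^sub>C\<^sub>L 'a. hilbert_schmidt C \<and> hilbert_schmidt D \<and> A = C o\<^sub>C D"
proof -
  obtain P B where pos: "positive_op P" and PP: "P o\<^sub>C P = adj A o\<^sub>C A" and B: "is_onb B"
    and sum: "(\<lambda>e. cinner e (P e)) summable_on B"
    using assms unfolding trace_class_def by blast
  obtain S :: "'a \<Rightarrow>\<^sub>C\<^sub>L 'a" where S: "\<And>x y. cinner (S x) y = cinner x (S y)" and SS: "S o\<^sub>C S = P"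
    using positive_op_sqrt[OF pos] by blast
  have P_apply: "P x = S (S x)" for x
    using SS by auto
  have "complex_of_real ((norm (S e))\<^sup>2) = cinner e (P e)" for e
    using S[of e "S e"] unfolding P_apply cinner_self .
  then have sq: "(norm (S e))\<^sup>2 = Re (cinner e (P e))" for e
    by (metis Re_complex_of_real)
  have "(\<lambda>e. Re (cinner e (P e))) summable_on B"
    using sum has_sum_Re unfolding summable_on_def by blast
  then have hs: "hilbert_schmidt S"
    using B unfolding hilbert_schmidt_def sq[symmetric] by blast
  have "norm (A x) = norm (P x)" for x
  proof -
    have "cinner (A x) (A x) = cinner x ((adj A o\<^sub>C A) x)"
      by (simp add: cinner_adj)
    also have "\<dots> = cinner (P x) (P x)"
      unfolding PP[symmetric] using positive_op_selfadjoint[OF pos, of x "P x"] by simp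
    finally have "(norm (A x))\<^sup>2 = (norm (P x))\<^sup>2"
      unfolding cinner_self of_real_eq_iff .
    then show ?thesis by simp
  qed
  then obtain W :: "'a \<Rightarrow>\<^sub>C\<^sub>L 'a" where W: "\<And>x y. cinner y (A x) = cinner (W y) (P x)"
    using douglas[of A 1 P] by force
  \<comment> \<open>\<open>adj W\<close> takes the place of the partial isometry in the polar
    decomposition \<open>A = V o\<^sub>C P\<close>.\<close>
  have "A = (adj W o\<^sub>C S) o\<^sub>C S"
    by (intro cblinfun_eqI cinner_ext) (simp add: W P_apply cinner_adj)
  then show ?thesis
    using hilbert_schmidt_compose_left[OF hs] hs by blast
qed

text \<open>A basis has to exist for uniqueness: without one, \<open>has_trace A z\<close> would
  hold for every \<open>z\<close>.\<close>

lemma tr_eqI: "has_trace (A :: 'a::chilbert_space \<Rightarrow>\<^sub>C\<^sub>L 'a) z \<Longrightarrow> is_onb (B :: 'a set) \<Longrightarrow> tr A = z"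
  unfolding tr_def has_trace_def by (rule the_equality) (auto dest: has_sum_unique)

lemma has_trace_add: "has_trace A a \<Longrightarrow> has_trace B b \<Longrightarrow> has_trace (A + B) (a + b)"
  unfolding has_trace_def by (simp add: cinner_add_right has_sum_add)

lemma has_trace_scaleC: "has_trace A a \<Longrightarrow> has_trace (c *\<^sub>C A) (c * a)"
  unfolding has_trace_def by (simp add: cinner_scaleC_right has_sum_cmult_right)

text \<open>The diagonal sum must be controlled in every basis, not only in \<open>B\<close>. With a
  finite basis all operators are Hilbert-Schmidt, so the product
  \<open>A o\<^sub>C id_cblinfun\<close> has a trace, and \<open>B\<close> computes it.\<close>

lemma has_trace_finite:
  fixes A :: "'a::chilbert_space \<Rightarrow>\<^sub>C\<^sub>L 'a"
  assumes B: "is_onb B" "finite B"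
  shows "has_trace A (\<Sum>e\<in>B. cinner e (A e))"
proof -
  have hs: "hilbert_schmidt T" for T :: "'a \<Rightarrow>\<^sub>C\<^sub>L 'a"
    using B unfolding hilbert_schmidt_def by (intro exI[of _ B]) simp
  obtain z where z: "has_trace (A o\<^sub>C id_cblinfun) z"
    using hilbert_schmidt_compose_has_trace[OF hs hs] by blast
  then have "((\<lambda>e. cinner e (A e)) has_sum z) B"
    using B(1) unfolding has_trace_def by simp
  then have "z = (\<Sum>e\<in>B. cinner e (A e))"
    using B(2) by (simp add: has_sum_finite_iff)
  moreover have "A o\<^sub>C id_cblinfun = A"
    by (intro cblinfun_eqI) simp
  ultimately show ?thesis using z by simp
qed

lemma tr_finite:
  "is_onb B \<Longrightarrow> finite B \<Longrightarrow> tr A = (\<Sum>e\<in>B. cinner e (cblinfun_apply A e))"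
  using tr_eqI[OF has_trace_finite] by blast

section \<open>Closed spans and unitary invariance of the trace\<close>

lemma csubspace_closure:
  assumes "complex_vector.subspace (S :: 'a::complex_normed_vector set)"
  shows "complex_vector.subspace (closure S)"
proof (rule complex_vector.subspaceI)
  show "0 \<in> closure S"
    using complex_vector.subspace_0[OF assms] closure_subset by blast
next
  fix x y assume "x \<in> closure S" "y \<in> closure S"
  then obtain a b where ab: "\<And>n. a n \<in> S" "a \<longlonglongrightarrow> x" "\<And>n. b n \<in> S" "b \<longlonglongrightarrow> y"
    unfolding closure_sequential by blast
  then show "x + y \<in> closure S"
    unfolding closure_sequential
    by (intro exI[of _ "\<lambda>n. a n + b n"])
      (auto intro: complex_vector.subspace_add[OF assms] tendsto_add)
next
  fix c x assume "x \<in> closure S"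
  then obtain a where a: "\<And>n. a n \<in> S" "a \<longlonglongrightarrow> x"
    unfolding closure_sequential by blast
  then show "c *\<^sub>C x \<in> closure S"
    unfolding closure_sequential
    by (intro exI[of _ "\<lambda>n. c *\<^sub>C a n"])
      (auto intro: complex_vector.subspace_scale[OF assms]
        bounded_linear.tendsto[OF bounded_linear_scaleC_right])
qed

lemma closure_cspan_minimal:
  assumes "T \<subseteq> closure (cspan B)"
  shows "closure (cspan T) \<subseteq> closure (cspan B)"
  by (intro closure_minimal closed_closure complex_vector.span_minimal assms
      csubspace_closure complex_vector.subspace_span)

lemma cblinfun_image_closure_cspan:
  "cblinfun_apply A ` closure (cspan B) \<subseteq> closure (cspan (A ` B))"
proof -
  interpret A: Vector_Spaces.linear scaleC scaleC "cblinfun_apply A"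
    by (rule clinear_cblinfun)
  show ?thesis
    unfolding A.span_image
    by (rule continuous_image_closure_subset[OF linear_continuous_on[OF bounded_linear_cblinfun] subset_UNIV])
qed

lemma unitary_adj_image_onb:
  assumes U: "unitary U" and B: "is_onb B"
  shows "is_onb (adj U ` B)"
proof -
  have 1: "adj U (U x) = x" "U (adj U x) = x" for x
    using U unfolding unitary_def by (metis cblinfun_compose_apply cblinfun_id_apply)+
  have inj: "adj U x = adj U y \<longleftrightarrow> x = y" for x y
    by (metis 1(2))
  have "cinner (adj U x) (adj U y) = cinner x y" for x y
    by (simp add: cinner_adj' 1)
  moreover have "y \<in> closure (cspan (adj U ` B))" for y
  proof -
    have "U y \<in> closure (cspan B)"
      using B unfolding is_onb_def by simp
    then show ?thesis
      using cblinfun_image_closure_cspan[of "adj U" B] 1(1)[of y] by (metis image_subset_iff)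
  qed
  ultimately show ?thesis
    using B inj unfolding is_onb_def by auto
qed

lemma has_trace_unitary:
  fixes A :: "'a::chilbert_space \<Rightarrow>\<^sub>C\<^sub>L 'a"
  assumes U: "unitary U" and A: "has_trace A z"
  shows "has_trace (U o\<^sub>C A o\<^sub>C adj U) z"
  unfolding has_trace_def
proof (intro allI impI)
  fix B :: "'a set" assume "is_onb B"
  then have "((\<lambda>e. cinner e (A e)) has_sum z) (adj U ` B)"
    using A unitary_adj_image_onb[OF U] unfolding has_trace_def by blast
  moreover have "inj_on (adj U) B"
  proof (rule inj_onI)
    fix x y assume "adj U x = adj U y"
    then have "(U o\<^sub>C adj U) x = (U o\<^sub>C adj U) y" by simp
    then show "x = y" using U unfolding unitary_def by simp
  qed
  ultimately show "((\<lambda>e. cinner e ((U o\<^sub>C A o\<^sub>C adj U) e)) has_sum z) B"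
    by (simp add: has_sum_reindex o_def cinner_adj')
qed

section \<open>Operators on a finite-dimensional space\<close>

definition ketbra :: "'a::complex_inner \<Rightarrow> 'a \<Rightarrow> 'a \<Rightarrow>\<^sub>C\<^sub>L 'a"
  where "ketbra u v = CBlinfun (\<lambda>x. cinner v x *\<^sub>C u)"

lemma ketbra_apply [simp]: "cblinfun_apply (ketbra u v) x = cinner v x *\<^sub>C u"
  unfolding ketbra_def
proof (rule CBlinfun_apply)
  show "norm (cinner v x *\<^sub>C u) \<le> norm v * norm u * norm x" for x
    using mult_right_mono[OF cinner_cauchy_schwarz[of v x] norm_ge_zero[of u]]
    by (simp add: norm_scaleC mult_ac)
qed (simp_all add: cinner_add_right scaleC_add_left cinner_scaleC_right scaleC_scaleC)

lemma ketbra_expansion: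
  assumes B: "is_onb B" "finite B"
  shows "(\<Sum>s\<in>B. \<Sum>s'\<in>B. cinner s (cblinfun_apply X s') *\<^sub>C ketbra s s') = X"
proof (rule cblinfun_eqI)
  fix x
  have "(\<Sum>s\<in>B. \<Sum>s'\<in>B. cinner s (X s') *\<^sub>C ketbra s s') x =
      (\<Sum>s\<in>B. cinner s (X (\<Sum>s'\<in>B. cinner s' x *\<^sub>C s')) *\<^sub>C s)"
    by (simp add: cblinfun_sum_left cblinfun_sum_right cinner_sum_right cblinfun_scaleC_right
        cinner_scaleC_right scaleC_scaleC complex_vector.scale_sum_left mult.commute)
  then show "(\<Sum>s\<in>B. \<Sum>s'\<in>B. cinner s (X s') *\<^sub>C ketbra s s') x = X x"
    by (simp add: finite_onb_expansion[OF B])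
qed

text \<open>\<open>Phi\<close> is a \<open>CBlinfun\<close>, so its defining map needs a norm bound.
  In finite dimension linearity suffices: the images of the matrix units give
  \<open>K\<close>.\<close>

lemma finite_dim_bounded:
  fixes f :: "('s::chilbert_space \<Rightarrow>\<^sub>C\<^sub>L 's) \<Rightarrow> 'b::complex_normed_vector"
  assumes B: "is_onb (B :: 's set)" "finite B"
    and add: "\<And>X Y. f (X + Y) = f X + f Y" and scale: "\<And>c X. f (c *\<^sub>C X) = c *\<^sub>C f X"
  shows "\<exists>K. \<forall>X. norm (f X) \<le> K * norm X"
proof -
  have f0: "f 0 = 0"
    using scale[of 0 0] by simp
  have f_sum: "f (\<Sum>i\<in>I. g i) = (\<Sum>i\<in>I. f (g i))" for g and I :: "'s set"
    by (induction I rule: infinite_finite_induct) (simp_all add: f0 add)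
  define K where "K = (\<Sum>s\<in>B. \<Sum>s'\<in>B. norm s * norm s' * norm (f (ketbra s s')))"
  have "norm (f X) \<le> K * norm X" for X
  proof -
    have "f X = (\<Sum>s\<in>B. \<Sum>s'\<in>B. cinner s (X s') *\<^sub>C f (ketbra s s'))"
      by (subst ketbra_expansion[OF B, of X, symmetric]) (simp add: f_sum scale)
    also have "norm \<dots> \<le> (\<Sum>s\<in>B. \<Sum>s'\<in>B. norm s * norm s' * norm (f (ketbra s s')) * norm X)"
    proof (intro order.trans[OF norm_sum] sum_mono)
      fix s s'
      have "cmod (cinner s (X s')) \<le> norm s * (norm X * norm s')"
        using cinner_cauchy_schwarz[of s "X s'"] mult_left_mono[OF norm_cblinfun_bound[of X s'] norm_ge_zero[of s]]
        by linarith
      from mult_right_mono[OF this norm_ge_zero[of "f (ketbra s s')"]]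
      show "norm (cinner s (X s') *\<^sub>C f (ketbra s s')) \<le> norm s * norm s' * norm (f (ketbra s s')) * norm X"
        by (simp add: norm_scaleC mult_ac)
    qed
    finally show ?thesis
      unfolding K_def by (simp add: sum_distrib_right)
  qed
  then show ?thesis by blast
qed

lemma has_trace_sum:
  "(\<And>i. i \<in> I \<Longrightarrow> has_trace (A i) (z i)) \<Longrightarrow> has_trace (\<Sum>i\<in>I. A i) (\<Sum>i\<in>I. z i)"
  by (induction I rule: infinite_finite_induct)
    (simp_all add: has_trace_add, simp_all add: has_trace_def)

text \<open>Finiteness of \<open>B\<close> lets row sums be glued one disjoint row at a time. For
  infinitely many rows iterated sums need not give a joint sum.\<close>

lemma has_sum_finite_Times:
  fixes f :: "'a \<times> 'b \<Rightarrow> 'c::topological_comm_monoid_add"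
  assumes "finite B" and "\<And>s. s \<in> B \<Longrightarrow> ((\<lambda>e. f (s, e)) has_sum g s) E"
  shows "(f has_sum (\<Sum>s\<in>B. g s)) (B \<times> E)"
  using assms
proof (induction B)
  case (insert s B)
  have "(f has_sum g s) (Pair s ` E)"
    using insert.prems[of s] by (subst has_sum_reindex) (auto simp: inj_on_def o_def)
  moreover have "(f has_sum (\<Sum>s\<in>B. g s)) (B \<times> E)"
    using insert by simp
  moreover have "Pair s ` E \<inter> B \<times> E = {}" "insert s B \<times> E = Pair s ` E \<union> B \<times> E"
    using insert.hyps by auto
  ultimately show ?case
    using insert.hyps by (simp add: has_sum_Un_disjoint)
qed simp

section \<open>Tensor products and partial traces\<close>

locale finite_tensor =
  fixes tens :: "'s::chilbert_space \<Rightarrow> 'e::chilbert_space \<Rightarrow> 'k::chilbert_space" and B :: "'s set"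
  assumes tensor: "is_tensor tens" and onb: "is_onb B" and fin: "finite B"
begin

lemma cinner_tens: "cinner (tens x y) (tens x' y') = cinner x x' * cinner y y'"
  using tensor unfolding is_tensor_def by blast

lemma tens_linear:
  "tens (x + x') y = tens x y + tens x' y" "tens (c *\<^sub>C x) y = c *\<^sub>C tens x y"
  "tens x (y + y') = tens x y + tens x y'" "tens x (c *\<^sub>C y) = c *\<^sub>C tens x y"
proof -
  interpret l: Vector_Spaces.linear scaleC scaleC "\<lambda>x. tens x y"
    using tensor unfolding is_tensor_def by blast
  interpret r: Vector_Spaces.linear scaleC scaleC "\<lambda>y. tens x y"
    using tensor unfolding is_tensor_def by blast
  show "tens (x + x') y = tens x y + tens x' y" "tens (c *\<^sub>C x) y = c *\<^sub>C tens x y"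
    by (rule l.add l.scale)+
  show "tens x (y + y') = tens x y + tens x y'" "tens x (c *\<^sub>C y) = c *\<^sub>C tens x y"
    by (rule r.add r.scale)+
qed

lemma norm_tens: "norm (tens x y) = norm x * norm y"
proof -
  have "complex_of_real ((norm (tens x y))\<^sup>2) = complex_of_real ((norm x * norm y)\<^sup>2)"
    unfolding cinner_self[symmetric] cinner_tens
    by (simp add: cinner_self power_mult_distrib)
  then have "(norm (tens x y))\<^sup>2 = (norm x * norm y)\<^sup>2"
    unfolding of_real_eq_iff .
  then show ?thesis
    by (simp add: power2_eq_iff_nonneg)
qed

text \<open>Compression by these maps turns partial traces into ordinary ones, since
  \<open>cinner (tens x e) (A (tens x' e))\<close> is the diagonal entry at \<open>e\<close> of
  \<open>adj (J x) o\<^sub>C A o\<^sub>C J x'\<close>.\<close>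

definition J :: "'s \<Rightarrow> 'e \<Rightarrow>\<^sub>C\<^sub>L 'k"
  where "J x = CBlinfun (tens x)"

lemma J_apply [simp]: "J x y = tens x y"
  unfolding J_def by (rule CBlinfun_apply[of _ "norm x"]) (simp_all add: tens_linear norm_tens)

lemma adj_J_tens [simp]: "adj (J x) (tens x' y) = cinner x x' *\<^sub>C y"
  by (rule cinner_ext) (simp add: cinner_adj[symmetric] cinner_tens cinner_scaleC_right)

lemma tens_expand: "tens x y = (\<Sum>s\<in>B. cinner s x *\<^sub>C tens s y)"
proof -
  have "tens (\<Sum>s\<in>I. c s *\<^sub>C s) y = (\<Sum>s\<in>I. c s *\<^sub>C tens s y)" for c and I :: "'s set"
    using tens_linear(2)[of 0 0 y]
    by (induction I rule: infinite_finite_induct) (simp_all add: tens_linear)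
  from this[of "\<lambda>s. cinner s x" B] show ?thesis
    by (simp add: finite_onb_expansion[OF onb fin])
qed

lemma adj_J_expand: "adj (J x) k = (\<Sum>s\<in>B. cinner x s *\<^sub>C adj (J s) k)"
proof (rule cinner_ext)
  fix y
  have "cinner y (adj (J x) k) = cinner (\<Sum>s\<in>B. cinner s x *\<^sub>C tens s y) k"
    by (simp add: cinner_adj[symmetric] flip: tens_expand)
  also have "\<dots> = (\<Sum>s\<in>B. cinner x s * cinner (tens s y) k)"
    unfolding cinner_sum_left cinner_scaleC_left by (metis cinner_commute)
  also have "\<dots> = cinner y (\<Sum>s\<in>B. cinner x s *\<^sub>C adj (J s) k)"
    by (simp add: cinner_sum_right cinner_scaleC_right cinner_adj[symmetric])
  finally show "cinner y (adj (J x) k) = cinner y (\<Sum>s\<in>B. cinner x s *\<^sub>C adj (J s) k)" .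
qed

text \<open>The equalizer is a closed subspace and the elementary tensors have dense span. This is
  the uniqueness half of the description \<open>op_tensor\<close>.\<close>

lemma tens_ext:
  fixes F G :: "'k \<Rightarrow>\<^sub>C\<^sub>L 'c::chilbert_space"
  assumes "\<And>x y. F (tens x y) = G (tens x y)"
  shows "F = G"
proof (rule cblinfun_eqI)
  fix k
  interpret F: Vector_Spaces.linear scaleC scaleC "cblinfun_apply F" by (rule clinear_cblinfun)
  interpret G: Vector_Spaces.linear scaleC scaleC "cblinfun_apply G" by (rule clinear_cblinfun)
  have "complex_vector.subspace {k. F k = G k}"
    by (rule complex_vector.subspaceI) (simp_all add: F.add G.add F.scale G.scale)
  then have "cspan {tens x y | x y. True} \<subseteq> {k. F k = G k}"
    by (intro complex_vector.span_minimal) (use assms in auto)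
  then have "closure (cspan {tens x y | x y. True}) \<subseteq> {k. F k = G k}"
    by (intro closure_minimal closed_Collect_eq linear_continuous_on bounded_linear_cblinfun)
  then show "F k = G k"
    using tensor unfolding is_tensor_def by auto
qed

lemma op_tensor_apply [simp]: "op_tensor tens X Y (tens x y) = tens (X x) (Y y)"
proof -
  \<comment> \<open>\<open>adj (J s)\<close> extracts the component along \<open>s\<close>,
    \<open>Y\<close> acts on it, and \<open>J (X s)\<close> reinserts it next to \<open>X s\<close>.
    As a finite sum of bounded operators, \<open>Z\<close> is bounded from the outset.\<close>
  define Z where "Z = (\<Sum>s\<in>B. J (X s) o\<^sub>C Y o\<^sub>C adj (J s))"
  have Z: "Z (tens x y) = tens (X x) (Y y)" for x y
  proof -
    have "tens (\<Sum>s\<in>I. c s *\<^sub>C X s) v = (\<Sum>s\<in>I. c s *\<^sub>C tens (X s) v)" for c v and I :: "'s set"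
      using tens_linear(2)[of 0 0 v]
      by (induction I rule: infinite_finite_induct) (simp_all add: tens_linear)
    from this[of "\<lambda>s. cinner s x" B "Y y"]
    have "Z (tens x y) = tens (X (\<Sum>s\<in>B. cinner s x *\<^sub>C s)) (Y y)"
      by (simp add: Z_def cblinfun_sum_left cblinfun_sum_right cblinfun_scaleC_right tens_linear)
    then show ?thesis
      by (simp add: finite_onb_expansion[OF onb fin])
  qed
  have "op_tensor tens X Y = Z"
    unfolding op_tensor_def
  proof (rule the_equality)
    fix Z' :: "'k \<Rightarrow>\<^sub>C\<^sub>L 'k" assume "\<forall>x y. Z' (tens x y) = tens (X x) (Y y)"
    then show "Z' = Z" by (intro tens_ext) (simp add: Z)
  qed (simp add: Z)
  then show ?thesis by (simp add: Z)
qed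

lemma op_tensor_add: "op_tensor tens (X + X') Y = op_tensor tens X Y + op_tensor tens X' Y"
  by (rule tens_ext) (simp add: tens_linear)

lemma op_tensor_scaleC: "op_tensor tens (c *\<^sub>C X) Y = c *\<^sub>C op_tensor tens X Y"
  by (rule tens_ext) (simp add: tens_linear)

text \<open>Totality goes one factor at a time: \<open>J s\<close> carries density of
  \<open>cspan E\<close> to the vectors \<open>tens s y\<close>, and a general
  \<open>tens x y\<close> is a finite combination of those. This also supplies the basis of
  \<open>'k\<close> that the Hilbert-Schmidt lemmas require.\<close>

lemma onb_tens:
  assumes E: "is_onb E"
  shows "is_onb ((\<lambda>(s, e). tens s e) ` (B \<times> E))" and "inj_on (\<lambda>(s, e). tens s e) (B \<times> E)"
proof -
  have ip: "cinner (tens s e) (tens s' e') = (if s = s' \<and> e = e' then 1 else 0)"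
    if "s \<in> B" "s' \<in> B" "e \<in> E" "e' \<in> E" for s s' e e'
    by (simp add: cinner_tens onb_cinner[OF onb that(1,2)] onb_cinner[OF E that(3,4)])
  have eq: "s = s' \<and> e = e'" if "s \<in> B" "s' \<in> B" "e \<in> E" "e' \<in> E" "tens s e = tens s' e'" for s s' e e'
    using ip[OF that(1-4)] ip[OF that(1,1,3,3)] that(5) by (auto split: if_splits)
  then show "inj_on (\<lambda>(s, e). tens s e) (B \<times> E)"
    by (auto simp: inj_on_def)
  let ?T = "(\<lambda>(s, e). tens s e) ` (B \<times> E)"
  have sub: "complex_vector.subspace (closure (cspan ?T))"
    by (intro csubspace_closure complex_vector.subspace_span)
  have "tens s y \<in> closure (cspan ?T)" if "s \<in> B" for s y
  proof -
    have "y \<in> closure (cspan E)"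
      using E unfolding is_onb_def by simp
    then have "tens s y \<in> closure (cspan (J s ` E))"
      using cblinfun_image_closure_cspan[of "J s" E] by (metis J_apply image_subset_iff)
    moreover have "J s ` E \<subseteq> ?T"
      using that by auto
    ultimately show ?thesis
      using closure_mono[OF complex_vector.span_mono] by blast
  qed
  then have "tens x y \<in> closure (cspan ?T)" for x y
    by (subst tens_expand) (intro complex_vector.subspace_sum[OF sub] complex_vector.subspace_scale[OF sub])
  then have "closure (cspan {tens x y | x y. True}) \<subseteq> closure (cspan ?T)"
    by (intro closure_cspan_minimal) auto
  then have "closure (cspan ?T) = UNIV"
    using tensor unfolding is_tensor_def by auto
  moreover have "\<forall>u\<in>?T. \<forall>v\<in>?T. cinner u v = (if u = v then 1 else 0)"
    using ip eq by auto
  ultimately show "is_onb ?T"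
    unfolding is_onb_def by blast
qed

text \<open>In a product basis the squared norms factor, and the factor from \<open>X\<close> is a
  finite sum.\<close>

lemma hilbert_schmidt_op_tensor:
  assumes "hilbert_schmidt C"
  shows "hilbert_schmidt (op_tensor tens X C)"
proof -
  obtain E z where E: "is_onb E" and z: "((\<lambda>e. (norm (C e))\<^sup>2) has_sum z) E"
    using assms unfolding hilbert_schmidt_def summable_on_def by blast
  have "((\<lambda>(s, e). (norm (tens (X s) (C e)))\<^sup>2) has_sum (\<Sum>s\<in>B. (norm (X s))\<^sup>2 * z)) (B \<times> E)"
    by (rule has_sum_finite_Times[OF fin])
      (simp add: norm_tens power_mult_distrib has_sum_cmult_right z)
  then have "((\<lambda>k. (norm (op_tensor tens X C k))\<^sup>2) has_sum (\<Sum>s\<in>B. (norm (X s))\<^sup>2 * z))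
      ((\<lambda>(s, e). tens s e) ` (B \<times> E))"
    by (subst has_sum_reindex[OF onb_tens(2)[OF E]]) (simp add: o_def case_prod_unfold)
  then show ?thesis
    using onb_tens(1)[OF E] unfolding hilbert_schmidt_def summable_on_def by blast
qed

section \<open>Traces in product bases and partial traces over the environment\<close>

lemma has_sum_tens:
  assumes z: "has_trace A z" and E: "is_onb (E :: 'e set)"
  shows "((\<lambda>(s, e). cinner (tens s e) (A (tens s e))) has_sum z) (B \<times> E)"
proof -
  have "((\<lambda>k. cinner k (A k)) has_sum z) ((\<lambda>(s, e). tens s e) ` (B \<times> E))"
    by (rule z[unfolded has_trace_def, rule_format, OF onb_tens(1)[OF E]])
  then show ?thesis
    by (subst (asm) has_sum_reindex[OF onb_tens(2)[OF E]]) (simp add: o_def case_prod_unfold)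
qed

lemma has_trace_op_tensor:
  assumes \<rho>: "has_trace \<rho> r" and E: "is_onb (E :: 'e set)" and z: "has_trace (op_tensor tens X \<rho>) z"
  shows "z = tr X * r"
proof -
  have "((\<lambda>(s, e). cinner (tens s e) (op_tensor tens X \<rho> (tens s e))) has_sum
      (\<Sum>s\<in>B. cinner s (X s) * r)) (B \<times> E)"
    by (rule has_sum_finite_Times[OF fin])
      (use \<rho> E in \<open>simp add: cinner_tens has_sum_cmult_right has_trace_def\<close>)
  moreover have "((\<lambda>(s, e). cinner (tens s e) (op_tensor tens X \<rho> (tens s e))) has_sum z) (B \<times> E)"
    by (rule has_sum_tens[OF z E])
  ultimately have "z = (\<Sum>s\<in>B. cinner s (X s) * r)"
    using has_sum_unique by blast
  then show ?thesis
    by (simp add: tr_finite[OF onb fin] sum_distrib_right)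
qed

text \<open>The condition inside \<open>ptrace_E\<close>, with every matrix entry written as an
  ordinary trace on the environment, so that linearity is inherited from
  \<open>has_trace\<close>.\<close>

definition is_ptrace :: "('k \<Rightarrow>\<^sub>C\<^sub>L 'k) \<Rightarrow> ('s \<Rightarrow>\<^sub>C\<^sub>L 's) \<Rightarrow> bool"
  where "is_ptrace A T \<longleftrightarrow> (\<forall>x x'. has_trace (adj (J x) o\<^sub>C A o\<^sub>C J x') (cinner x (T x')))"

lemma ptrace_E_eqI:
  assumes T: "is_ptrace A T" and E: "is_onb (E :: 'e set)"
  shows "ptrace_E tens A = T"
  unfolding ptrace_E_def
proof (rule the_equality)
  show T': "\<forall>B. is_onb B \<longrightarrow> (\<forall>x x'.
      ((\<lambda>e. cinner (tens x e) (A (tens x' e))) has_sum cinner x (T x')) B)"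
    using T unfolding is_ptrace_def has_trace_def by (simp flip: cinner_adj)
  fix S :: "'s \<Rightarrow>\<^sub>C\<^sub>L 's"
  assume "\<forall>B. is_onb B \<longrightarrow> (\<forall>x x'.
      ((\<lambda>e. cinner (tens x e) (A (tens x' e))) has_sum cinner x (S x')) B)"
  then show "S = T"
    using T' E by (intro cblinfun_eqI cinner_ext) (blast intro: has_sum_unique)
qed

lemma is_ptrace_exists:
  assumes C: "hilbert_schmidt (C :: 'k \<Rightarrow>\<^sub>C\<^sub>L 'k)" and D: "hilbert_schmidt (D :: 'k \<Rightarrow>\<^sub>C\<^sub>L 'k)"
    and E: "is_onb (E :: 'e set)"
  shows "\<exists>T. is_ptrace (C o\<^sub>C D) T"
proof -
  let ?A = "C o\<^sub>C D"
  note K = onb_tens(1)[OF E]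
  have "\<exists>z. has_trace (adj (J x) o\<^sub>C ?A o\<^sub>C J x') z" for x x'
  proof -
    \<comment> \<open>Each compression attaches to one factor, leaving a product of two
      Hilbert-Schmidt operators that passes from \<open>'e\<close> through \<open>'k\<close> back to
      \<open>'e\<close>.\<close>
    have "adj (J x) o\<^sub>C ?A o\<^sub>C J x' = (adj (J x) o\<^sub>C C) o\<^sub>C (D o\<^sub>C J x')"
      by (intro cblinfun_eqI) simp
    then show ?thesis
      using hilbert_schmidt_compose_has_trace[OF hilbert_schmidt_compose_left[OF C]
          hilbert_schmidt_compose_right[OF D K E]] by simp
  qed
  then obtain F where F: "\<And>x x'. has_trace (adj (J x) o\<^sub>C ?A o\<^sub>C J x') (F x x')"
    by metis
  \<comment> \<open>The operator with matrix \<open>F\<close> in the basis \<open>B\<close>.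
    Expanding \<open>x\<close> and \<open>x'\<close> in \<open>B\<close> shows that it has the right
    entries at all vectors.\<close>
  define T where "T = (\<Sum>s\<in>B. \<Sum>s'\<in>B. F s s' *\<^sub>C ketbra s s')"
  have "has_trace (adj (J x) o\<^sub>C ?A o\<^sub>C J x') (cinner x (T x'))" for x x'
  proof -
    have "adj (J x) o\<^sub>C ?A o\<^sub>C J x' =
        (\<Sum>s\<in>B. \<Sum>s'\<in>B. (cinner x s * cinner s' x') *\<^sub>C (adj (J s) o\<^sub>C ?A o\<^sub>C J s'))"
    proof (rule cblinfun_eqI)
      fix y
      have "(adj (J x) o\<^sub>C ?A o\<^sub>C J x') y =
          (\<Sum>s\<in>B. cinner x s *\<^sub>C adj (J s) (?A (\<Sum>s'\<in>B. cinner s' x' *\<^sub>C tens s' y)))"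
        by (simp add: adj_J_expand[of x] flip: tens_expand)
      then show "(adj (J x) o\<^sub>C ?A o\<^sub>C J x') y =
          (\<Sum>s\<in>B. \<Sum>s'\<in>B. (cinner x s * cinner s' x') *\<^sub>C (adj (J s) o\<^sub>C ?A o\<^sub>C J s')) y"
        by (simp add: cblinfun_sum_left cblinfun_sum_right cblinfun_scaleC_right
            complex_vector.scale_sum_right scaleC_scaleC)
    qed
    moreover have "cinner x (T x') = (\<Sum>s\<in>B. \<Sum>s'\<in>B. (cinner x s * cinner s' x') * F s s')"
      by (simp add: T_def cblinfun_sum_left cinner_sum_right cinner_scaleC_right mult_ac)
    moreover have "has_trace
        (\<Sum>s\<in>B. \<Sum>s'\<in>B. (cinner x s * cinner s' x') *\<^sub>C (adj (J s) o\<^sub>C ?A o\<^sub>C J s'))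
        (\<Sum>s\<in>B. \<Sum>s'\<in>B. (cinner x s * cinner s' x') * F s s')"
      by (intro has_trace_sum has_trace_scaleC F)
    ultimately show ?thesis by simp
  qed
  then show ?thesis
    unfolding is_ptrace_def by blast
qed

lemma is_ptrace_add:
  assumes "is_ptrace A T" "is_ptrace A' T'"
  shows "is_ptrace (A + A') (T + T')"
  unfolding is_ptrace_def
proof (intro allI)
  fix x x'
  have "adj (J x) o\<^sub>C (A + A') o\<^sub>C J x' = (adj (J x) o\<^sub>C A o\<^sub>C J x') + (adj (J x) o\<^sub>C A' o\<^sub>C J x')"
    by (intro cblinfun_eqI) (simp add: cblinfun_add_right)
  then show "has_trace (adj (J x) o\<^sub>C (A + A') o\<^sub>C J x') (cinner x ((T + T') x'))"
    using assms unfolding is_ptrace_def by (simp add: cinner_add_right has_trace_add)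
qed

lemma is_ptrace_scaleC:
  assumes "is_ptrace A T"
  shows "is_ptrace (c *\<^sub>C A) (c *\<^sub>C T)"
  unfolding is_ptrace_def
proof (intro allI)
  fix x x'
  have "adj (J x) o\<^sub>C (c *\<^sub>C A) o\<^sub>C J x' = c *\<^sub>C (adj (J x) o\<^sub>C A o\<^sub>C J x')"
    by (intro cblinfun_eqI) (simp add: cblinfun_scaleC_right)
  then show "has_trace (adj (J x) o\<^sub>C (c *\<^sub>C A) o\<^sub>C J x') (cinner x ((c *\<^sub>C T) x'))"
    using assms unfolding is_ptrace_def by (simp add: cinner_scaleC_right has_trace_scaleC)
qed

text \<open>Row \<open>s\<close> of the diagonal sum in a product basis is the matrix entry
  \<open>cinner s (T s)\<close>, so summing all rows computes both traces.\<close>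

lemma tr_ptrace:
  assumes T: "is_ptrace A T" and z: "has_trace A z" and E: "is_onb (E :: 'e set)"
  shows "tr T = z"
proof -
  have "((\<lambda>e. cinner (tens s e) (A (tens s e))) has_sum cinner s (T s)) E" for s
    using T[unfolded is_ptrace_def has_trace_def, rule_format, OF E, of s s]
    by (simp flip: cinner_adj)
  then have "((\<lambda>(s, e). cinner (tens s e) (A (tens s e))) has_sum (\<Sum>s\<in>B. cinner s (T s))) (B \<times> E)"
    by (intro has_sum_finite_Times[OF fin]) simp
  moreover have "((\<lambda>(s, e). cinner (tens s e) (A (tens s e))) has_sum z) (B \<times> E)"
    by (rule has_sum_tens[OF z E])
  ultimately have "(\<Sum>s\<in>B. cinner s (T s)) = z"
    by (rule has_sum_unique)
  then show ?thesis
    by (simp add: tr_finite[OF onb fin])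
qed

end

section \<open>Reduced dynamics\<close>

text \<open>Applying \<open>\<tau>\<close> to \<open>F X + \<tau> X *\<^sub>C v = Y\<close> gives
  \<open>\<tau> X = \<tau> Y\<close>, after which the equation is solved by \<open>F\<close>. It is
  the Sherman-Morrison formula, whose denominator \<open>1 + \<tau> (inv F v)\<close> equals 1
  here.\<close>

lemma rank_one_perturbation_inverse:
  fixes F G :: "'a::complex_normed_vector \<Rightarrow>\<^sub>C\<^sub>L 'a" and \<tau> :: "'a \<Rightarrow> complex"
  assumes G: "\<And>X. G X = F X + \<tau> X *\<^sub>C v" and \<tau>_F: "\<And>X. \<tau> (F X) = \<tau> X" and \<tau>_v: "\<tau> v = 0"
    and \<tau>_add: "\<And>X Y. \<tau> (X + Y) = \<tau> X + \<tau> Y" and \<tau>_scale: "\<And>c X. \<tau> (c *\<^sub>C X) = c * \<tau> X"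
    and F: "bij (cblinfun_apply F)"
  shows "bij (cblinfun_apply G)"
    and "inv (cblinfun_apply G) X = inv (cblinfun_apply F) X - \<tau> X *\<^sub>C inv (cblinfun_apply F) v"
proof -
  let ?f = "inv (cblinfun_apply F)"
  have F_inv: "F (?f X) = X" and inv_F: "?f (F X) = X" for X
    using F by (simp_all add: bij_is_surj surj_f_inv_f bij_is_inj)
  have inv_add: "?f (X + c *\<^sub>C Y) = ?f X + c *\<^sub>C ?f Y" for X Y c
    using inv_F[of "?f X + c *\<^sub>C ?f Y"] by (simp add: cblinfun_add_right cblinfun_scaleC_right F_inv)
  have \<tau>_inv: "\<tau> (?f X) = \<tau> X" for X
    using \<tau>_F[of "?f X"] by (simp add: F_inv)
  have \<tau>_diff: "\<tau> (X - c *\<^sub>C Y) = \<tau> X - c * \<tau> Y" for X Y c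
    using \<tau>_add[of "X - c *\<^sub>C Y" "c *\<^sub>C Y"] by (simp add: \<tau>_scale)
  define H where "H X = ?f X - \<tau> X *\<^sub>C ?f v" for X
  have GH: "G (H X) = X" for X
    unfolding G H_def
    by (simp add: \<tau>_diff \<tau>_inv \<tau>_v cblinfun_diff_right cblinfun_scaleC_right F_inv)
  have HG: "H (G X) = X" for X
    unfolding G H_def inv_add by (simp add: \<tau>_add \<tau>_scale \<tau>_F \<tau>_v inv_F)
  show "bij (cblinfun_apply G)"
    by (rule o_bij[of H]) (simp_all add: fun_eq_iff GH HG)
  have "inv (cblinfun_apply G) = H"
    by (rule inv_unique_comp) (simp_all add: fun_eq_iff GH HG)
  then show "inv (cblinfun_apply G) X = ?f X - \<tau> X *\<^sub>C ?f v"
    by (simp add: H_def)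
qed

lemma compose_conj_factor:
  fixes C :: "'c::chilbert_space \<Rightarrow>\<^sub>C\<^sub>L 'c" and D :: "'a::chilbert_space \<Rightarrow>\<^sub>C\<^sub>L 'c"
    and U :: "'c \<Rightarrow>\<^sub>C\<^sub>L 'c"
  shows "U o\<^sub>C (C o\<^sub>C D) o\<^sub>C V = (U o\<^sub>C C) o\<^sub>C (D o\<^sub>C V)"
  by (rule cblinfun_eqI) simp

context finite_tensor
begin

section \<open>Trace identities for \<open>Phi\<close> and \<open>Icorr\<close>\<close>

lemma tr_add: "tr (X + Y) = tr X + tr (Y :: 's \<Rightarrow>\<^sub>C\<^sub>L 's)"
  by (simp add: tr_finite[OF onb fin] cinner_add_right sum.distrib)

lemma tr_scaleC: "tr (c *\<^sub>C X) = c * tr (X :: 's \<Rightarrow>\<^sub>C\<^sub>L 's)"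
  by (simp add: tr_finite[OF onb fin] cinner_scaleC_right sum_distrib_left)

lemma norm_tr_le: "cmod (tr (X :: 's \<Rightarrow>\<^sub>C\<^sub>L 's)) \<le> real (card B) * norm X"
proof -
  have "cmod (cinner s (X s)) \<le> norm X" if "s \<in> B" for s
  proof -
    have "cinner s s = 1" using onb_cinner[OF onb that that] by simp
    then have "(norm s)\<^sup>2 = 1\<^sup>2"
      unfolding cinner_self of_real_eq_1_iff by simp
    then have "norm s = 1"
      by (rule power2_eq_imp_eq) simp_all
    then show ?thesis
      using cinner_cauchy_schwarz[of s "X s"] norm_cblinfun_bound[of X s] by simp
  qed
  then have "cmod (\<Sum>s\<in>B. cinner s (X s)) \<le> (\<Sum>s\<in>B. norm X)"
    by (intro order.trans[OF norm_sum] sum_mono)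
  then show ?thesis
    by (simp add: tr_finite[OF onb fin])
qed

text \<open>The two Hilbert-Schmidt factors absorb \<open>U\<close> and \<open>adj U\<close>, so the
  conjugate is again such a product. Unitary invariance lets \<open>z\<close> be the trace of
  \<open>A\<close> itself.\<close>

lemma is_ptrace_conj_exists:
  fixes C D :: "'k \<Rightarrow>\<^sub>C\<^sub>L 'k"
  assumes U: "unitary U" and C: "hilbert_schmidt C" and D: "hilbert_schmidt D" and E: "is_onb (E :: 'e set)"
    and A: "A = C o\<^sub>C D"
  shows "\<exists>T z. is_ptrace (U o\<^sub>C A o\<^sub>C adj U) T \<and> has_trace A z \<and> tr T = z"
proof -
  obtain z where z: "has_trace A z"
    unfolding A using hilbert_schmidt_compose_has_trace[OF C D] by blast
  obtain T where "is_ptrace (U o\<^sub>C A o\<^sub>C adj U) T"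
    unfolding A compose_conj_factor
    using is_ptrace_exists[OF hilbert_schmidt_compose_left[OF C]
        hilbert_schmidt_compose_right[OF D onb_tens(1)[OF E] onb_tens(1)[OF E]] E] by blast
  then show ?thesis
    using tr_ptrace[OF _ has_trace_unitary[OF U z] E] z by blast
qed

text \<open>The trace of the partial trace is \<open>tr X * tr \<rho>\<close>. Most of the proof
  verifies that the map inside \<open>CBlinfun\<close> is linear and bounded, without which
  \<open>Phi\<close> could not be evaluated.\<close>

lemma tr_Phi:
  assumes U: "unitary (U s)" and \<rho>: "trace_class \<rho>" and tr_\<rho>: "tr \<rho> = 1"
  shows "tr (Phi tens U \<rho> s X) = tr X"
proof -
  obtain C D :: "'e \<Rightarrow>\<^sub>C\<^sub>L 'e" where C: "hilbert_schmidt C" and D: "hilbert_schmidt D" and CD: "\<rho> = C o\<^sub>C D"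
    using trace_class_factorization[OF \<rho>] by blast
  obtain E :: "'e set" where E: "is_onb E"
    using D unfolding hilbert_schmidt_def by blast
  obtain r where r: "has_trace \<rho> r"
    unfolding CD using hilbert_schmidt_compose_has_trace[OF C D] by blast
  then have r1: "has_trace \<rho> 1"
    using tr_eqI[OF r E] tr_\<rho> by simp
  let ?A = "\<lambda>X. U s o\<^sub>C op_tensor tens X \<rho> o\<^sub>C adj (U s)"
  have "\<exists>T. is_ptrace (?A X) T \<and> tr T = tr X" for X
  proof -
    \<comment> \<open>The factorization of \<open>\<rho>\<close> lifts to the tensor product;
      placing \<open>X\<close> with either factor keeps both Hilbert-Schmidt.\<close>
    have fac: "op_tensor tens X \<rho> = op_tensor tens id_cblinfun C o\<^sub>C op_tensor tens X D"
      by (rule tens_ext) (simp add: CD)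
    show ?thesis
      using is_ptrace_conj_exists[OF U hilbert_schmidt_op_tensor[OF C] hilbert_schmidt_op_tensor[OF D] E fac]
        has_trace_op_tensor[OF r1 E] by (metis mult.right_neutral)
  qed
  then obtain f where f: "\<And>X. is_ptrace (?A X) (f X)" and tr_f: "\<And>X. tr (f X) = tr X"
    by metis
  have f_eq: "ptrace_E tens (?A X) = f X" for X
    by (rule ptrace_E_eqI[OF f E])
  have f_add: "f (X + Y) = f X + f Y" for X Y
  proof -
    have "?A (X + Y) = ?A X + ?A Y"
      by (rule cblinfun_eqI) (simp add: op_tensor_add cblinfun_add_right)
    then show ?thesis
      using ptrace_E_eqI[OF is_ptrace_add[OF f f] E, of X Y] by (simp flip: f_eq)
  qed
  have f_scale: "f (c *\<^sub>C X) = c *\<^sub>C f X" for c X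
  proof -
    have "?A (c *\<^sub>C X) = c *\<^sub>C ?A X"
      by (rule cblinfun_eqI) (simp add: op_tensor_scaleC cblinfun_scaleC_right)
    then show ?thesis
      using ptrace_E_eqI[OF is_ptrace_scaleC[OF f] E, of c X] by (simp flip: f_eq)
  qed
  obtain K where "\<And>X. norm (f X) \<le> K * norm X"
    using finite_dim_bounded[OF onb fin f_add f_scale] by blast
  then have "Phi tens U \<rho> s X = f X"
    unfolding Phi_def f_eq by (rule CBlinfun_apply[OF f_add f_scale])
  then show ?thesis
    by (simp add: tr_f)
qed

text \<open>A vanishing partial trace forces \<open>chi\<close> to have trace 0, and conjugation by
  \<open>U s\<close> preserves this.\<close>

lemma tr_Icorr:
  assumes U: "unitary (U s)" and chi: "trace_class chi" and ptr: "ptrace_E tens chi = 0"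
    and E: "is_onb (E :: 'e set)"
  shows "tr (Icorr tens U chi s) = 0"
proof -
  obtain C D :: "'k \<Rightarrow>\<^sub>C\<^sub>L 'k" where C: "hilbert_schmidt C" and D: "hilbert_schmidt D" and CD: "chi = C o\<^sub>C D"
    using trace_class_factorization[OF chi] by blast
  obtain T z where T: "is_ptrace (U s o\<^sub>C chi o\<^sub>C adj (U s)) T" and z: "has_trace chi z" "tr T = z"
    using is_ptrace_conj_exists[OF U C D E CD] by blast
  obtain T0 where T0: "is_ptrace chi T0"
    unfolding CD using is_ptrace_exists[OF C D E] by blast
  have "z = tr (0 :: 's \<Rightarrow>\<^sub>C\<^sub>L 's)"
    using tr_ptrace[OF T0 z(1) E] ptrace_E_eqI[OF T0 E] ptr by simp
  also have "\<dots> = 0"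
    by (simp add: tr_finite[OF onb fin])
  finally show ?thesis
    using ptrace_E_eqI[OF T E] z(2) unfolding Icorr_def by simp
qed

text \<open>It makes the correction term of \<open>Psi\<close> the image of \<open>Icorr\<close>
  under a bounded linear map, which commutes with differentiation.\<close>

definition tr_times :: "('s \<Rightarrow>\<^sub>C\<^sub>L 's) \<Rightarrow> ('s \<Rightarrow>\<^sub>C\<^sub>L 's) \<Rightarrow>\<^sub>C\<^sub>L ('s \<Rightarrow>\<^sub>C\<^sub>L 's)"
  where "tr_times V = CBlinfun (\<lambda>X. tr X *\<^sub>C V)"

lemma norm_tr_scaleC_le:
  fixes X :: "'s \<Rightarrow>\<^sub>C\<^sub>L 's" and V :: "'b::complex_normed_vector"
  shows "norm (tr X *\<^sub>C V) \<le> real (card B) * norm V * norm X"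
  using mult_right_mono[OF norm_tr_le[of X] norm_ge_zero[of V]] by (simp add: norm_scaleC mult_ac)

lemma tr_times_apply [simp]: "tr_times V X = tr X *\<^sub>C V"
  unfolding tr_times_def
  by (rule CBlinfun_apply[OF _ _ norm_tr_scaleC_le])
    (simp_all add: tr_add tr_scaleC scaleC_add_left scaleC_scaleC)

lemma bounded_linear_tr_times: "bounded_linear tr_times"
proof (rule bounded_linear_intro)
  show "tr_times (V + W) = tr_times V + tr_times W" for V W
    by (rule cblinfun_eqI) (simp add: scaleC_add_right)
  show "tr_times (r *\<^sub>R V) = r *\<^sub>R tr_times V" for r V
    by (rule cblinfun_eqI) (simp add: scaleR_scaleC scaleC_scaleC mult.commute)
  show "norm (tr_times V) \<le> norm V * real (card B)" for V
    by (rule norm_cblinfun_le) (simp_all add: norm_tr_scaleC_le mult.commute[of "norm V"])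
qed

text \<open>The function inside \<open>CBlinfun\<close> is already the application of an operator,
  so the description is resolved by injectivity of \<open>cblinfun_apply\<close>.\<close>

lemma Psi_eq: "Psi tens U \<rho> chi s = Phi tens U \<rho> s + tr_times (Icorr tens U chi s)"
proof -
  have eq: "(\<lambda>X. Phi tens U \<rho> s X + tr X *\<^sub>C Icorr tens U chi s) =
      cblinfun_apply (Phi tens U \<rho> s + tr_times (Icorr tens U chi s))"
    by (simp add: fun_eq_iff)
  show ?thesis
    unfolding Psi_def CBlinfun_def eq cblinfun_apply_inject by simp
qed

lemma tderiv_Psi:
  assumes "Phi tens U \<rho> differentiable (at t within {0..})"
    and "Icorr tens U chi differentiable (at t within {0..})" and t: "t \<ge> 0"
  shows "tderiv (Psi tens U \<rho> chi) t = tderiv (Phi tens U \<rho>) t + tr_times (tderiv (Icorr tens U chi) t)"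
proof -
  \<comment> \<open>Derivatives are unique only along a nontrivial filter; the right-hand
    neighbourhoods provide this also at the endpoint \<open>t = 0\<close>.\<close>
  have "at_right t \<le> at t within {0..}"
    using t by (intro at_le) auto
  then have "at t within {0..} \<noteq> bot"
    using trivial_limit_at_right_real[of t] by (metis bot.extremum_uniqueI)
  moreover have "(Psi tens U \<rho> chi has_vector_derivative
      tderiv (Phi tens U \<rho>) t + tr_times (tderiv (Icorr tens U chi) t)) (at t within {0..})"
    unfolding tderiv_def Psi_eq[abs_def]
    by (intro has_vector_derivative_add
        bounded_linear.has_vector_derivative[OF bounded_linear_tr_times]
        assms(1,2)[unfolded vector_derivative_works])
  ultimately show ?thesis
    unfolding tderiv_def by (rule vector_derivative_within)
qed

end

lemma finite_onb_exists:
  fixes B :: "'s::complex_inner set"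
  assumes "finite B" "cspan B = UNIV"
  shows "\<exists>C :: 's set. finite C \<and> is_onb C"
proof -
  obtain C where C: "finite C" "\<forall>x\<in>C. \<forall>y\<in>C. cinner x y = (if x = y then 1 else 0)" "cspan C = cspan B"
    using gram_schmidt[OF assms(1)] by (elim exE conjE)
  then have "is_onb C"
    unfolding is_onb_def C(3) assms(2) closure_UNIV by blast
  with C(1) show ?thesis by blast
qed

theorem mainTheorem3:
  fixes tens :: "'s::chilbert_space \<Rightarrow> 'e::chilbert_space \<Rightarrow> 'k::chilbert_space"
    and U :: "real \<Rightarrow> 'k \<Rightarrow>\<^sub>C\<^sub>L 'k" and \<rho> :: "'e \<Rightarrow>\<^sub>C\<^sub>L 'e" and chi :: "'k \<Rightarrow>\<^sub>C\<^sub>L 'k"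
    and t :: real
  assumes "\<exists>B :: 's set. finite B \<and> cspan B = UNIV"
    and "is_tensor tens"
    and "\<forall>s\<ge>0. unitary (U s)"
    and "density_op \<rho>"
    and "hermitian chi" and "trace_class chi"
    and "ptrace_E tens chi = 0" and "ptrace_S tens chi = 0"
    and "\<forall>s\<ge>0. Phi tens U \<rho> differentiable (at s within {0..})"
    and "\<forall>s\<ge>0. Icorr tens U chi differentiable (at s within {0..})"
    and "t \<ge> 0"
  shows "(bij (cblinfun_apply (Psi tens U \<rho> chi t)) \<longleftrightarrow> bij (cblinfun_apply (Phi tens U \<rho> t)))
    \<and> (bij (cblinfun_apply (Phi tens U \<rho> t)) \<longrightarrow>
        (\<forall>X. inv (cblinfun_apply (Psi tens U \<rho> chi t)) X =
             inv (cblinfun_apply (Phi tens U \<rho> t)) X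
               - tr X *\<^sub>C inv (cblinfun_apply (Phi tens U \<rho> t)) (Icorr tens U chi t)))
    \<and> (bij (cblinfun_apply (Phi tens U \<rho> t)) \<longrightarrow>
        (\<forall>X. generator (Psi tens U \<rho> chi) t X =
             generator (Phi tens U \<rho>) t X
               + tr X *\<^sub>C (tderiv (Icorr tens U chi) t
                   - generator (Phi tens U \<rho>) t (Icorr tens U chi t))))"
proof -
  obtain B :: "'s set" where B: "finite B" "is_onb B"
    using assms(1) finite_onb_exists by blast
  interpret finite_tensor tens B
    using assms(2) B by unfold_locales
  have \<rho>: "trace_class \<rho>" "tr \<rho> = 1"
    using assms(4) unfolding density_op_def by blast+
  obtain E :: "'e set" where E: "is_onb E"
    using \<rho>(1) unfolding trace_class_def by blast
  have U: "unitary (U t)"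
    using assms(3,11) by blast
  let ?F = "Phi tens U \<rho> t" and ?G = "Psi tens U \<rho> chi t" and ?I = "Icorr tens U chi t"
  have G: "?G X = ?F X + tr X *\<^sub>C ?I" for X
    by (simp add: Psi_eq)
  have tr_F: "tr (?F X) = tr X" for X
    by (rule tr_Phi[where U = U and s = t, OF U \<rho>])
  have tr_I: "tr ?I = 0"
    by (rule tr_Icorr[where U = U and s = t, OF U assms(6,7) E])
  note pert = rank_one_perturbation_inverse[OF G tr_F tr_I tr_add tr_scaleC]
  \<comment> \<open>The roles are exchanged: \<open>?G\<close> also preserves the trace, and
    perturbing it by \<open>- ?I\<close>, again of trace 0, gives back \<open>?F\<close>.\<close>
  have converse_bij: "bij (cblinfun_apply ?F)" if bij_G: "bij (cblinfun_apply ?G)"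
  proof (rule rank_one_perturbation_inverse(1)[OF _ _ _ tr_add tr_scaleC bij_G])
    show "?F X = ?G X + tr X *\<^sub>C ((- 1) *\<^sub>C ?I)" for X
      by (simp add: G)
    show "tr (?G X) = tr X" for X
      by (simp add: G tr_add tr_scaleC tr_F tr_I)
    show "tr ((- 1) *\<^sub>C ?I) = 0"
      unfolding tr_scaleC tr_I by simp
  qed
  have gen: "generator (Psi tens U \<rho> chi) t X = generator (Phi tens U \<rho>) t X
      + tr X *\<^sub>C (tderiv (Icorr tens U chi) t - generator (Phi tens U \<rho>) t ?I)"
    if bij_F: "bij (cblinfun_apply ?F)" for X
  proof -
    let ?f = "inv (cblinfun_apply ?F)"
    \<comment> \<open>Since \<open>?G\<close> preserves the trace, so does its inverse; hence the
      derivative of \<open>Icorr\<close> enters the generator with the factor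
      \<open>tr X\<close>.\<close>
    have tr_G: "tr (inv (cblinfun_apply ?G) X) = tr X"
    proof -
      have "tr (?G (inv (cblinfun_apply ?G) X)) = tr X"
        using pert(1)[OF bij_F] by (simp add: bij_is_surj surj_f_inv_f)
      then show ?thesis
        by (simp add: G tr_add tr_scaleC tr_F tr_I)
    qed
    have "generator (Psi tens U \<rho> chi) t X =
        tderiv (Phi tens U \<rho>) t (inv (cblinfun_apply ?G) X) + tr X *\<^sub>C tderiv (Icorr tens U chi) t"
      using tderiv_Psi[of U \<rho> t chi] assms(9-11) by (simp add: generator_def tr_G)
    also have "\<dots> = tderiv (Phi tens U \<rho>) t (?f X) - tr X *\<^sub>C tderiv (Phi tens U \<rho>) t (?f ?I)
        + tr X *\<^sub>C tderiv (Icorr tens U chi) t"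
      by (simp add: pert(2)[OF bij_F] cblinfun_diff_right cblinfun_scaleC_right)
    finally show ?thesis
      by (simp add: generator_def complex_vector.scale_right_diff_distrib)
  qed
  show ?thesis
  proof (intro conjI impI iffI allI)
    show "bij (cblinfun_apply ?F)" if "bij (cblinfun_apply ?G)"
      by (rule converse_bij[OF that])
    show "bij (cblinfun_apply ?G)" if "bij (cblinfun_apply ?F)"
      by (rule pert(1)[OF that])
  qed (simp_all only: pert(2) gen)
qed

end
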